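(* Let $F:\mathbb{R}^n\to\mathbb{R}^n$ be continuously differentiable and $q:\mathbb{R}^n\to(-\infty,\infty]$ closed proper convex. Let $\bar x$ be a solution of $0\in F(x)+\partial q(x)$, assume that $\partial q$ is SCD semismooth* at $(\bar x,-F(\bar x))$ and that $F+\partial q$ is SCD regular around $(\bar x,0)$. Then Algorithm A (the SCD semismooth* Newton method in the context) is an instance of Algorithm B (the G-semismooth Newton method in the context): every sequence $\{x^{(k)}\}$ generated by Algorithm A from a starting point $x^{(0)}$ with parameters $\{\gamma^{(k)}\}$ is also generated by Algorithm B from $x^{(0)}$ with the same parameters $\{\gamma^{(k)}\}$ (for suitable choices of $V^{(k)}$). Consequently, the local superlinear convergence of Algorithm A follows from that of Algorithm B: for every $\underline\gamma,\bar\gamma$ with $0<\underline\gamma\le\bar\gamma$ there exists a neighborhood $U$ of $\bar x$ such that for every starting point $x^{(0)}\in U$ Algorithm A produces a sequence $\{x^{(k)}\}$ converging superlinearly to $\bar x$, provided $\gamma^{(k)}\in[\underline\gamma,\bar\gamma]$ is chosen in every iteration.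
   Context: Derivative notions. Let $\mathcal X$ be an $n$-dimensional real Hilbert space. $\mathbb Z_n$ is the metric space of $n$-dimensional subspaces of $\mathcal X\times\mathcal X$ with metric $\|\Pi_{L_1}-\Pi_{L_2}\|$ ($\Pi_L$ orthogonal projection). For $L\in\mathbb Z_n$, $L^*:=\{(-v^*;u^* )\mid(u^*;v^* )\in L^\perp\}$. For $\Phi:\mathcal X\rightrightarrows\mathcal X$ with closed graph, $\widehat{\mathcal S}^*_\Phi(x,y):=\{(T_{\operatorname{gph}\Phi}(x;y))^*\}$ if $(x;y)\in\operatorname{gph}\Phi$ and the contingent (Bouligand) cone $T_{\operatorname{gph}\Phi}(x;y)$ belongs to $\mathbb Z_n$, and $\widehat{\mathcal S}^*_\Phi(x,y):=\emptyset$ otherwise. $\mathcal S^*_\Phi(x,y):=\limsup_{(u;v)\to(x;y),\,(u;v)\in\operatorname{gph}\Phi}\widehat{\mathcal S}^*_\Phi(u,v)$ (all limits in $\mathbb Z_n$ of sequences $L_k\in\widehat{\mathcal S}^*_\Phi(u_k,v_k)$ with $(u_k;v_k)\to(x;y)$ in $\operatorname{gph}\Phi$). $\Phi$ has the SCD property around $(x,y)\in\operatorname{gph}\Phi$ if $\mathcal S^*_\Phi(x',y')\ne\emptyset$ for all $(x';y')\in\operatorname{gph}\Phi$ near $(x;y)$. $\Phi$ is SCD regular around $(x,y)$ if it has the SCD property around $(x,y)$ and every $L\in\mathcal S^*_\Phi(x,y)$ satisfies: $(y^*;0)\in L\Rightarrow y^*=0$. $\Phi$ is SCD semismooth* at $(\bar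 x,\bar y)\in\operatorname{gph}\Phi$ if it has the SCD property around $(\bar x,\bar y)$ and for every $\epsilon>0$ there is $\delta>0$ such that $|\langle x^*,x-\bar x\rangle-\langle y^*,y-\bar y\rangle|\le\epsilon\|(x;y)-(\bar x;\bar y)\|\|(x^*;y^* )\|$ for all $(x;y)\in\operatorname{gph}\Phi$ within distance $\delta$ of $(\bar x;\bar y)$ and all $(y^*;x^* )\in\bigcup\mathcal S^*_\Phi(x,y)$ (the union of the subspaces in $\mathcal S^*_\Phi(x,y)$). Proximal notions. For $\gamma>0$, $\mathcal P_{\gamma^{-1}q}(z):=\arg\min_w\{q(w)+\frac{\gamma}{2}\|w-z\|^2\}$ and $u_\gamma(x):=\mathcal P_{\gamma^{-1}q}(x-\gamma^{-1}F(x))-x$. The Bouligand subdifferential $\partial_B\Psi(z)$ of a locally Lipschitz map $\Psi$ is the set of limits of $\Psi'(z_k)$ over $z_k\to z$ with $\Psi$ differentiable at $z_k$. Define $\mathcal T_{u_\gamma}(x):=\{B(I-\gamma^{-1}F'(x))-I\mid B\in\partial_B\mathcal P_{\gamma^{-1}q}(x-\gamma^{-1}F(x))\}$. For $n\times n$ matrices $Y,X$, $\operatorname{rge}(Y;X)=\{(Yw;Xw)\mid w\in\mathbb R^n\}$. Algorithm A. For $k=0,1,\dots$: (1) if $0\in F(x^{(k)})+\partial q(x^{(k)})$, stop; (2) select $\gamma^{(k)}>0$ and compute $u^{(k)}:=u_{\gamma^{(k)}}(x^{(k)})$, $\hat d^{(k)}:=x^{(k)}+u^{(k)}$, $\hat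 d^{*(k)}:=-\gamma^{(k)}u^{(k)}-F(x^{(k)})$; (3) select $n\times n$ matrices $(X^{*(k)},Y^{*(k)})$ with $\operatorname{rge}(Y^{*(k)};X^{*(k)})\in\mathcal S^*_{\partial q}(\hat d^{(k)},\hat d^{*(k)})$, compute $\Delta x^{(k)}$ from $(Y^{*(k)\top}F'(x^{(k)})+X^{*(k)\top})\Delta x^{(k)}=(\gamma^{(k)}Y^{*(k)\top}+X^{*(k)\top})u^{(k)}$, and set $x^{(k+1)}:=x^{(k)}+\Delta x^{(k)}$. Algorithm B. For $k=0,1,\dots$: (1) if $0\in F(x^{(k)})+\partial q(x^{(k)})$, stop; (2) select $\gamma^{(k)}>0$ and compute $u^{(k)}:=u_{\gamma^{(k)}}(x^{(k)})$; (3) select $V^{(k)}\in\mathcal T_{u_{\gamma^{(k)}}}(x^{(k)})$, compute $\Delta x^{(k)}$ from $V^{(k)}\Delta x^{(k)}=-u^{(k)}$, and set $x^{(k+1)}:=x^{(k)}+\Delta x^{(k)}$. Superlinear convergence means $x^{(k)}\to\bar x$ with $\|x^{(k+1)}-\bar x\|=o(\|x^{(k)}-\bar x\|)$; finite termination at $\bar x$ is included as a degenerate case. *)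

theory Defs
  imports "HOL-Analysis.Analysis" "HOL-Library.Landau_Symbols" "HOL-Library.Extended_Nat"
begin

definition orth_proj :: "'b::euclidean_space set \<Rightarrow> 'b \<Rightarrow> 'b" where
  "orth_proj L z = (THE p. p \<in> L \<and> (\<forall>w\<in>L. orthogonal (z - p) w))"

definition Zn :: "('a::euclidean_space \<times> 'a) set set" where
  "Zn = {L. subspace L \<and> dim L = DIM('a)}"

definition Zn_dist :: "('a::euclidean_space \<times> 'a) set \<Rightarrow> ('a \<times> 'a) set \<Rightarrow> real" where
  "Zn_dist L1 L2 = onorm (\<lambda>z. orth_proj L1 z - orth_proj L2 z)"

definition adj :: "('a::euclidean_space \<times> 'a) set \<Rightarrow> ('a \<times> 'a) set" where
  "adj L = {(- v, u) | u v. (u, v) \<in> L\<^sup>\<bottom>}"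

text \<open>The contingent (Bouligand) cone to \<open>A\<close> at \<open>z\<close>; it is only used for \<open>z \<in> A\<close>.\<close>

definition contingent_cone :: "'b::real_normed_vector set \<Rightarrow> 'b \<Rightarrow> 'b set" where
  "contingent_cone A z =
     {w. \<exists>(t :: nat \<Rightarrow> real) W. (\<forall>k. t k > 0) \<and> t \<longlonglongrightarrow> 0 \<and> W \<longlonglongrightarrow> w
                              \<and> (\<forall>k. z + t k *\<^sub>R W k \<in> A)}"

definition gph :: "('a \<Rightarrow> 'b set) \<Rightarrow> ('a \<times> 'b) set" where
  "gph \<Phi> = {(x, y). y \<in> \<Phi> x}"

definition S_hat :: "('a::euclidean_space \<Rightarrow> 'a set) \<Rightarrow> 'a \<times> 'a \<Rightarrow> ('a \<times> 'a) set set" where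
  "S_hat \<Phi> p = (if p \<in> gph \<Phi> \<and> contingent_cone (gph \<Phi>) p \<in> Zn
                then {adj (contingent_cone (gph \<Phi>) p)} else {})"

definition S_star :: "('a::euclidean_space \<Rightarrow> 'a set) \<Rightarrow> 'a \<times> 'a \<Rightarrow> ('a \<times> 'a) set set" where
  "S_star \<Phi> p = {L \<in> Zn. \<exists>(P :: nat \<Rightarrow> 'a \<times> 'a) Lk. (\<forall>k. P k \<in> gph \<Phi>) \<and> P \<longlonglongrightarrow> p
                     \<and> (\<forall>k. Lk k \<in> S_hat \<Phi> (P k)) \<and> (\<lambda>k. Zn_dist (Lk k) L) \<longlonglongrightarrow> 0}"

definition SCD_around :: "('a::euclidean_space \<Rightarrow> 'a set) \<Rightarrow> 'a \<times> 'a \<Rightarrow> bool" where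
  "SCD_around \<Phi> p \<longleftrightarrow> p \<in> gph \<Phi> \<and> (\<forall>\<^sub>F p' in nhds p. p' \<in> gph \<Phi> \<longrightarrow> S_star \<Phi> p' \<noteq> {})"

definition SCD_regular_around :: "('a::euclidean_space \<Rightarrow> 'a set) \<Rightarrow> 'a \<times> 'a \<Rightarrow> bool" where
  "SCD_regular_around \<Phi> p \<longleftrightarrow>
     SCD_around \<Phi> p \<and> (\<forall>L \<in> S_star \<Phi> p. \<forall>ys. (ys, 0) \<in> L \<longrightarrow> ys = 0)"

definition SCD_semismooth_at :: "('a::euclidean_space \<Rightarrow> 'a set) \<Rightarrow> 'a \<times> 'a \<Rightarrow> bool" where
  "SCD_semismooth_at \<Phi> p \<longleftrightarrow> SCD_around \<Phi> p \<and>
     (\<forall>\<epsilon>>0. \<exists>\<delta>>0. \<forall>x y xs ys.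
        (x, y) \<in> gph \<Phi> \<and> dist (x, y) p \<le> \<delta> \<and> (ys, xs) \<in> \<Union> (S_star \<Phi> (x, y)) \<longrightarrow>
        \<bar>xs \<bullet> (x - fst p) - ys \<bullet> (y - snd p)\<bar> \<le> \<epsilon> * norm ((x, y) - p) * norm (xs, ys))"

definition closed_proper_convex :: "('a::euclidean_space \<Rightarrow> ereal) \<Rightarrow> bool" where
  "closed_proper_convex q \<longleftrightarrow>
     closed {(x, r :: real). q x \<le> ereal r} \<and> convex {(x, r :: real). q x \<le> ereal r} \<and>
     (\<forall>x. q x \<noteq> - \<infinity>) \<and> (\<exists>x. q x \<noteq> \<infinity>)"

definition subdiff :: "('a::euclidean_space \<Rightarrow> ereal) \<Rightarrow> 'a \<Rightarrow> 'a set" where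
  "subdiff q x = {v. q x \<noteq> \<infinity> \<and> (\<forall>y. q y \<ge> q x + ereal (v \<bullet> (y - x)))}"

definition plus_map :: "('a \<Rightarrow> 'a::plus) \<Rightarrow> ('a \<Rightarrow> 'a set) \<Rightarrow> 'a \<Rightarrow> 'a set" where
  "plus_map F \<Phi> x = {F x + v | v. v \<in> \<Phi> x}"

text \<open>\<open>prox \<gamma> q\<close> is the proximal mapping of \<open>\<gamma>\<^sup>-\<^sup>1q\<close>. For closed proper convex \<open>q\<close>
  and \<open>\<gamma> > 0\<close> the minimizer exists and is unique, so \<open>arg_min\<close> is not an arbitrary choice.\<close>

definition prox :: "real \<Rightarrow> ('a::euclidean_space \<Rightarrow> ereal) \<Rightarrow> 'a \<Rightarrow> 'a" where
  "prox \<gamma> q z = arg_min (\<lambda>w. q w + ereal (\<gamma> / 2 * (norm (w - z))\<^sup>2)) (\<lambda>w. True)"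

definition prox_step :: "real \<Rightarrow> ('a::euclidean_space \<Rightarrow> 'a) \<Rightarrow> ('a \<Rightarrow> ereal) \<Rightarrow> 'a \<Rightarrow> 'a" where
  "prox_step \<gamma> F q x = prox \<gamma> q (x - (1 / \<gamma>) *\<^sub>R F x) - x"

definition bouligand_subdiff :: "(real^'n \<Rightarrow> real^'n) \<Rightarrow> real^'n \<Rightarrow> (real^'n^'n) set" where
  "bouligand_subdiff \<Psi> z =
     {B. \<exists>Z :: nat \<Rightarrow> real^'n. Z \<longlonglongrightarrow> z \<and> (\<forall>k. \<Psi> differentiable at (Z k))
                              \<and> (\<lambda>k. jacobian \<Psi> (at (Z k))) \<longlonglongrightarrow> B}"

definition T_u :: "real \<Rightarrow> (real^'n \<Rightarrow> real^'n) \<Rightarrow> (real^'n \<Rightarrow> ereal) \<Rightarrow> real^'n \<Rightarrow> (real^'n^'n) set" where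
  "T_u \<gamma> F q x =
     {B ** (mat 1 - (1 / \<gamma>) *\<^sub>R jacobian F (at x)) - mat 1 | B.
        B \<in> bouligand_subdiff (prox \<gamma> q) (x - (1 / \<gamma>) *\<^sub>R F x)}"

definition rge :: "real^'n^'n \<Rightarrow> real^'n^'n \<Rightarrow> ((real^'n) \<times> (real^'n)) set" where
  "rge Y X = range (\<lambda>w. (Y *v w, X *v w))"

definition solves :: "('a::euclidean_space \<Rightarrow> 'a) \<Rightarrow> ('a \<Rightarrow> ereal) \<Rightarrow> 'a \<Rightarrow> bool" where
  "solves F q x \<longleftrightarrow> 0 \<in> plus_map F (subdiff q) x"

text \<open>The matrices \<open>X\<close>, \<open>Y\<close> that may be selected in Algorithm A (the SCD semismooth*
  Newton method) at the iterate \<open>x\<close>, and the linear system that the Newton direction \<open>dx\<close>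
  has to solve there.\<close>

definition algA_select ::
  "(real^'n \<Rightarrow> real^'n) \<Rightarrow> (real^'n \<Rightarrow> ereal) \<Rightarrow> real \<Rightarrow> real^'n \<Rightarrow> real^'n^'n \<Rightarrow> real^'n^'n \<Rightarrow> bool" where
  "algA_select F q \<gamma> x X Y \<longleftrightarrow>
     (let u = prox_step \<gamma> F q x; d = x + u; ds = - (\<gamma> *\<^sub>R u) - F x
      in rge Y X \<in> S_star (subdiff q) (d, ds))"

definition algA_eq ::
  "(real^'n \<Rightarrow> real^'n) \<Rightarrow> (real^'n \<Rightarrow> ereal) \<Rightarrow> real \<Rightarrow> real^'n \<Rightarrow> real^'n^'n \<Rightarrow> real^'n^'n
    \<Rightarrow> real^'n \<Rightarrow> bool" where
  "algA_eq F q \<gamma> x X Y dx \<longleftrightarrow>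
     (transpose Y ** jacobian F (at x) + transpose X) *v dx
       = (\<gamma> *\<^sub>R transpose Y + transpose X) *v prox_step \<gamma> F q x"

text \<open>\<open>algA F q \<gamma> X Y N x\<close>: the iterations \<open>k < N\<close> of Algorithm A can be carried out without
  stopping, with parameters \<open>\<gamma> k\<close> and matrices \<open>X k\<close>, \<open>Y k\<close>, and produce \<open>x 0, \<dots>, x N\<close> (all of
  \<open>x\<close> if \<open>N = \<infinity>\<close>). For finite \<open>N\<close> entries beyond \<open>N\<close> are irrelevant, and it is not required that
  the method stops at \<open>x N\<close>, so prefixes of runs are covered. Likewise for \<open>algB\<close>, which
  describes Algorithm B (the G-semismooth Newton method).\<close>

definition algA ::
  "(real^'n \<Rightarrow> real^'n) \<Rightarrow> (real^'n \<Rightarrow> ereal) \<Rightarrow> (nat \<Rightarrow> real) \<Rightarrow> (nat \<Rightarrow> real^'n^'n)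
    \<Rightarrow> (nat \<Rightarrow> real^'n^'n) \<Rightarrow> enat \<Rightarrow> (nat \<Rightarrow> real^'n) \<Rightarrow> bool" where
  "algA F q \<gamma> X Y N x \<longleftrightarrow>
     (\<forall>k. enat k < N \<longrightarrow> \<not> solves F q (x k) \<and> \<gamma> k > 0 \<and> algA_select F q (\<gamma> k) (x k) (X k) (Y k) \<and>
        (\<exists>dx. algA_eq F q (\<gamma> k) (x k) (X k) (Y k) dx \<and> x (Suc k) = x k + dx))"

definition algB ::
  "(real^'n \<Rightarrow> real^'n) \<Rightarrow> (real^'n \<Rightarrow> ereal) \<Rightarrow> (nat \<Rightarrow> real) \<Rightarrow> (nat \<Rightarrow> real^'n^'n)
    \<Rightarrow> enat \<Rightarrow> (nat \<Rightarrow> real^'n) \<Rightarrow> bool" where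
  "algB F q \<gamma> V N x \<longleftrightarrow>
     (\<forall>k. enat k < N \<longrightarrow> \<not> solves F q (x k) \<and> \<gamma> k > 0 \<and> V k \<in> T_u (\<gamma> k) F q (x k) \<and>
        (\<exists>dx. V k *v dx = - prox_step (\<gamma> k) F q (x k) \<and> x (Suc k) = x k + dx))"

text \<open>A run is complete if it is infinite or the stopping test succeeds at its last iterate.\<close>

definition complete_run ::
  "('a::euclidean_space \<Rightarrow> 'a) \<Rightarrow> ('a \<Rightarrow> ereal) \<Rightarrow> enat \<Rightarrow> (nat \<Rightarrow> 'a) \<Rightarrow> bool" where
  "complete_run F q N x \<longleftrightarrow> (\<forall>m. N = enat m \<longrightarrow> solves F q (x m))"

definition superlinear :: "enat \<Rightarrow> (nat \<Rightarrow> 'a::euclidean_space) \<Rightarrow> 'a \<Rightarrow> bool" where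
  "superlinear N x xbar \<longleftrightarrow>
     (case N of
        enat m \<Rightarrow> x m = xbar
      | \<infinity> \<Rightarrow> x \<longlonglongrightarrow> xbar \<and>
             (\<lambda>k. norm (x (Suc k) - xbar)) \<in> o(\<lambda>k. norm (x k - xbar)))"

end

theory Submission
  imports Defs
begin

text \<open>
  The graph of \<open>\<partial>q\<close> is a linear image of the graph of the nonexpansive map \<open>P = prox c q\<close>. Its
  contingent cone at a point is an \<open>n\<close>-dimensional subspace exactly when \<open>P\<close> is differentiable at the
  corresponding parameter \<open>z\<close>, and so the subspaces in \<open>S_star (subdiff q)\<close> are the ranges
  \<open>rge (B\<^sup>T; c (I - B\<^sup>T))\<close> with \<open>B\<close> in the Bouligand subdifferential of \<open>P\<close> at \<open>z\<close>.
  With \<open>c = \<gamma>\<close>, an invertible factor cancels from the Newton system of Algorithm A, which leaves that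
  of Algorithm B.

  For the convergence take \<open>c = 1\<close>, independently of \<open>\<gamma>\<close>: the system becomes
  \<open>(B F'(x) + I - B) dx = (\<gamma> B + I - B) u\<close>. SCD regularity transfers to \<open>\<partial>q\<close> through the change of
  variables \<open>(x, y) \<mapsto> (x, F x + y)\<close> and, by compactness, bounds the inverses of these matrices uniformly
  near \<open>xbar\<close>, while semismoothness* makes \<open>(I - B) (d - xbar) - B (ds + F xbar)\<close> small relative to
  \<open>x - xbar\<close>, where \<open>(d, ds)\<close> is the point of the graph computed from \<open>x\<close>.
\<close>

subsection \<open>Orthogonal projections and the gap metric\<close>

text \<open>Convergence is proved directly on the linear system of Algorithm A; no convergence
  theorem for Algorithm B enters. The obstacle to taking \<open>c = \<gamma>\<close> there is that
  \<gamma> changes from iteration to iteration, and with it the map \<open>prox \<gamma> q\<close>.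
  The graph of \<open>subdiff q\<close> does not depend on \<gamma>, so with one fixed
  \<open>c\<close> all its derivatives are described by the Bouligand subdifferential of a single
  map. Only one inclusion is established for each operator: every element of
  \<open>S_star (subdiff q)\<close> has the stated form, whereas the ranges belonging to F +
  \<partial>q are shown to be elements, which is the direction that a regularity hypothesis on all
  elements calls for. The transposes come from the duality in \<open>adj\<close>, since the tangent
  spaces themselves are given by B; they disappear in the Newton system, where the selected matrices
  enter transposed.\<close>

lemma orth_proj_unique:
  fixes L :: "'b::euclidean_space set"
  assumes "subspace L" "p \<in> L" "\<And>w. w \<in> L \<Longrightarrow> (z - p) \<bullet> w = 0"
  shows "orth_proj L z = p"
  unfolding orth_proj_def
proof (rule the_equality)
  show "p \<in> L \<and> (\<forall>w\<in>L. orthogonal (z - p) w)"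
    using assms by (simp add: orthogonal_def)
next
  fix p' assume p': "p' \<in> L \<and> (\<forall>w\<in>L. orthogonal (z - p') w)"
  have "p' - p \<in> L" using p' assms by (simp add: subspace_diff)
  then have "(z - p) \<bullet> (p' - p) = 0" "(z - p') \<bullet> (p' - p) = 0"
    using assms p' by (auto simp: orthogonal_def)
  then have "(p' - p) \<bullet> (p' - p) = 0" by (simp add: inner_diff_left)
  then show "p' = p" by simp
qed

lemma orth_proj:
  fixes L :: "'b::euclidean_space set"
  assumes "subspace L"
  shows orth_proj_mem: "orth_proj L z \<in> L"
    and orth_proj_orthogonal: "w \<in> L \<Longrightarrow> (z - orth_proj L z) \<bullet> w = 0"
proof -
  obtain y r where yr: "y \<in> span L" "\<And>w. w \<in> span L \<Longrightarrow> orthogonal r w" "z = y + r"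
    using orthogonal_subspace_decomp_exists[of L z] by metis
  then have "y \<in> L" "\<And>w. w \<in> L \<Longrightarrow> (z - y) \<bullet> w = 0"
    using assms by (auto simp: orthogonal_def span_eq_iff[THEN iffD2])
  moreover from this have "orth_proj L z = y" using assms by (intro orth_proj_unique)
  ultimately show "orth_proj L z \<in> L" "w \<in> L \<Longrightarrow> (z - orth_proj L z) \<bullet> w = 0" by auto
qed

lemma orth_proj_eq_self_iff:
  assumes "subspace L"
  shows "orth_proj L z = z \<longleftrightarrow> z \<in> L"
  using orth_proj_mem[OF assms, of z] orth_proj_unique[OF assms, of z z] by auto

lemma norm_diff_orth_proj_le:
  fixes L :: "'b::euclidean_space set"
  assumes "subspace L" "p \<in> L"
  shows "norm (z - orth_proj L z) \<le> norm (z - p)"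
proof -
  have "(z - orth_proj L z) \<bullet> (orth_proj L z - p) = 0"
    using assms by (simp add: orth_proj subspace_diff)
  then have "(norm (z - p))\<^sup>2 = (norm (z - orth_proj L z))\<^sup>2 + (norm (orth_proj L z - p))\<^sup>2"
    using norm_add_Pythagorean[of "z - orth_proj L z" "orth_proj L z - p"]
    by (simp add: orthogonal_def)
  then have "(norm (z - orth_proj L z))\<^sup>2 \<le> (norm (z - p))\<^sup>2"
    using zero_le_power2[of "norm (orth_proj L z - p)"] by linarith
  then show ?thesis by (rule power2_le_imp_le) simp
qed

lemma linear_orth_proj:
  fixes L :: "'b::euclidean_space set"
  assumes "subspace L"
  shows "linear (orth_proj L)"
proof (rule linearI)
  fix a b c
  show "orth_proj L (a + b) = orth_proj L a + orth_proj L b"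
    using assms orth_proj_orthogonal[OF assms, of _ a] orth_proj_orthogonal[OF assms, of _ b]
    by (intro orth_proj_unique) (auto simp: orth_proj_mem subspace_add inner_diff_left inner_add_left)
  show "orth_proj L (c *\<^sub>R a) = c *\<^sub>R orth_proj L a"
    using assms orth_proj_orthogonal[OF assms, of _ a]
    by (intro orth_proj_unique) (auto simp: orth_proj_mem subspace_scale inner_diff_left)
qed

lemma norm_orth_proj_le:
  assumes "subspace L"
  shows "norm (orth_proj L z) \<le> norm z" "norm (z - orth_proj L z) \<le> norm z"
proof -
  have "(z - orth_proj L z) \<bullet> orth_proj L z = 0" using assms by (simp add: orth_proj)
  then have "(norm z)\<^sup>2 = (norm (z - orth_proj L z))\<^sup>2 + (norm (orth_proj L z))\<^sup>2"
    using norm_add_Pythagorean[of "z - orth_proj L z" "orth_proj L z"] by (simp add: orthogonal_def)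
  then have "(norm (orth_proj L z))\<^sup>2 \<le> (norm z)\<^sup>2"
    "(norm (z - orth_proj L z))\<^sup>2 \<le> (norm z)\<^sup>2"
    using zero_le_power2[of "norm (orth_proj L z)"] zero_le_power2[of "norm (z - orth_proj L z)"]
    by linarith+
  then show "norm (orth_proj L z) \<le> norm z" "norm (z - orth_proj L z) \<le> norm z"
    using power2_le_imp_le norm_ge_zero by blast+
qed

lemma bounded_linear_orth_proj_diff:
  assumes "subspace L1" "subspace L2"
  shows "bounded_linear (\<lambda>z. orth_proj L1 z - orth_proj L2 z)"
  using assms by (simp add: linear_conv_bounded_linear[symmetric] linear_orth_proj linear_compose_sub)

lemma Zn_dist_nonneg:
  assumes "subspace L1" "subspace L2"
  shows "0 \<le> Zn_dist L1 L2"
  unfolding Zn_dist_def using bounded_linear_orth_proj_diff[OF assms] by (rule onorm_pos_le)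

text \<open>Uses \<open>\<Pi>\<^sub>1 - \<Pi>\<^sub>2 = (I - \<Pi>\<^sub>2) \<Pi>\<^sub>1 - \<Pi>\<^sub>2 (I - \<Pi>\<^sub>1)\<close>, where \<open>\<Pi>\<^sub>2 (I - \<Pi>\<^sub>1)\<close> is the adjoint
  of \<open>(I - \<Pi>\<^sub>1) \<Pi>\<^sub>2\<close>.\<close>

lemma Zn_dist_le:
  assumes L1: "subspace L1" and L2: "subspace L2" and "0 \<le> d"
    and d12: "\<And>z. z \<in> L1 \<Longrightarrow> \<exists>p\<in>L2. norm (z - p) \<le> d * norm z"
    and d21: "\<And>z. z \<in> L2 \<Longrightarrow> \<exists>p\<in>L1. norm (z - p) \<le> d * norm z"
  shows "Zn_dist L1 L2 \<le> 2 * d"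
  unfolding Zn_dist_def
proof (rule onorm_bound)
  show "0 \<le> 2 * d" using \<open>0 \<le> d\<close> by simp
next
  fix z
  have b12: "norm (w - orth_proj L2 w) \<le> d * norm w" if "w \<in> L1" for w
    using d12[OF that] norm_diff_orth_proj_le[OF L2] order_trans by blast
  have b21: "norm (w - orth_proj L1 w) \<le> d * norm w" if "w \<in> L2" for w
    using d21[OF that] norm_diff_orth_proj_le[OF L1] order_trans by blast
  define p where "p = orth_proj L1 z"
  define r where "r = z - p"
  define s where "s = orth_proj L2 r"
  have r_le: "norm r \<le> norm z" unfolding r_def p_def by (rule norm_orth_proj_le[OF L1])
  have "s \<in> L2" by (simp add: s_def orth_proj_mem[OF L2])
  have ss: "s \<bullet> s = s \<bullet> r"
    using orth_proj_orthogonal[OF L2 \<open>s \<in> L2\<close>, of r]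
    by (simp add: s_def[symmetric] inner_diff_left inner_commute[of s r])
  \<comment> \<open>\<open>r\<close> is orthogonal to \<open>L1\<close>, so subtracting the
    projection of \<open>s\<close> onto \<open>L1\<close> changes nothing, and the gap bound for
    elements of \<open>L2\<close> becomes applicable.\<close>
  also have "s \<bullet> r = (s - orth_proj L1 s) \<bullet> r"
    using orth_proj_orthogonal[OF L1 orth_proj_mem[OF L1], of z s]
    by (simp add: r_def p_def inner_diff_left inner_diff_right inner_commute)
  also have "\<dots> \<le> norm (s - orth_proj L1 s) * norm r" by (rule norm_cauchy_schwarz)
  also have "\<dots> \<le> (d * norm s) * norm z"
    using b21[OF \<open>s \<in> L2\<close>] r_le \<open>0 \<le> d\<close> by (intro mult_mono) auto
  finally have "norm s * norm s \<le> norm s * (d * norm z)"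
    by (simp add: dot_square_norm power2_eq_square mult_ac)
  then have s_le: "norm s \<le> d * norm z"
    using \<open>0 \<le> d\<close> by (cases "norm s = 0") auto
  have "norm (p - orth_proj L2 p) \<le> d * norm p" by (rule b12) (simp add: p_def orth_proj_mem[OF L1])
  also have "\<dots> \<le> d * norm z"
    using norm_orth_proj_le[OF L1, of z] \<open>0 \<le> d\<close> by (simp add: p_def mult_left_mono)
  finally have p_le: "norm (p - orth_proj L2 p) \<le> d * norm z" .
  have "orth_proj L2 z = orth_proj L2 p + s"
    using linear_add[OF linear_orth_proj[OF L2], of p r] by (simp add: s_def r_def)
  then have "norm (orth_proj L1 z - orth_proj L2 z) = norm ((p - orth_proj L2 p) - s)"
    by (simp add: p_def algebra_simps)
  also have "\<dots> \<le> norm (p - orth_proj L2 p) + norm s" by (rule norm_triangle_ineq4)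
  finally show "norm (orth_proj L1 z - orth_proj L2 z) \<le> 2 * d * norm z"
    using p_le s_le by simp
qed

lemma Zn_dist_tendsto_orth_proj:
  assumes "\<And>k. subspace (Lk k)" "subspace L" "(\<lambda>k. Zn_dist (Lk k) L) \<longlonglongrightarrow> 0"
  shows "(\<lambda>k. orth_proj (Lk k) z) \<longlonglongrightarrow> orth_proj L z"
proof -
  have "norm (orth_proj (Lk k) z - orth_proj L z) \<le> Zn_dist (Lk k) L * norm z" for k
    unfolding Zn_dist_def using bounded_linear_orth_proj_diff[OF assms(1,2)] by (rule onorm)
  then have "\<forall>\<^sub>F k in sequentially.
      norm (orth_proj (Lk k) z - orth_proj L z) \<le> Zn_dist (Lk k) L * norm z"
    by simp
  moreover have "(\<lambda>k. Zn_dist (Lk k) L * norm z) \<longlonglongrightarrow> 0"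
    using assms(3) by (rule tendsto_mult_left_zero)
  ultimately have "(\<lambda>k. orth_proj (Lk k) z - orth_proj L z) \<longlonglongrightarrow> 0"
    by (rule Lim_null_comparison)
  then show ?thesis by (simp add: LIM_zero_iff)
qed

text \<open>A subspace is the fixed-point set of its projection, and the projections converge
  pointwise. This identifies a subspace known only as a limit with an explicit limit along a
  subsequence.\<close>

lemma Zn_dist_limit_unique:
  assumes "\<And>k. subspace (Lk k)" "subspace L" "subspace L'"
    and "(\<lambda>k. Zn_dist (Lk k) L) \<longlonglongrightarrow> 0" "(\<lambda>k. Zn_dist (Lk k) L') \<longlonglongrightarrow> 0"
  shows "L = L'"
proof -
  have "orth_proj L z = orth_proj L' z" for z
    using Zn_dist_tendsto_orth_proj[OF assms(1,2,4)] Zn_dist_tendsto_orth_proj[OF assms(1,3,5)]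
    by (rule LIMSEQ_unique)
  then show ?thesis
    using orth_proj_eq_self_iff[OF assms(2)] orth_proj_eq_self_iff[OF assms(3)] by auto
qed

subsection \<open>Ranges of matrix pairs\<close>

lemma bounded_bilinear_matrix_vector_mult:
  "bounded_bilinear ((*v) :: real^'n^'m \<Rightarrow> real^'n \<Rightarrow> real^'m)"
  unfolding bilinear_conv_bounded_bilinear[symmetric] bilinear_def
  by (intro conjI allI linearI)
    (simp_all only: matrix_vector_mult_add_rdistrib scaleR_matrix_vector_assoc
      matrix_vector_right_distrib matrix_vector_mult_scaleR)

lemma bounded_bilinear_matrix_matrix_mult:
  "bounded_bilinear ((**) :: real^'n^'m \<Rightarrow> real^'k^'n \<Rightarrow> real^'k^'m)"
  unfolding bilinear_conv_bounded_bilinear[symmetric] bilinear_def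
  by (intro conjI allI linearI)
    (simp_all add: matrix_matrix_mult_def vec_eq_iff sum.distrib sum_distrib_left algebra_simps)

lemmas matrix_vector_mult_minus_right =
  bounded_bilinear.minus_right[OF bounded_bilinear_matrix_vector_mult]

lemmas tendsto_matrix_vector_mult [tendsto_intros] =
  bounded_bilinear.tendsto[OF bounded_bilinear_matrix_vector_mult]

lemmas tendsto_matrix_matrix_mult [tendsto_intros] =
  bounded_bilinear.tendsto[OF bounded_bilinear_matrix_matrix_mult]

lemma tendsto_transpose [tendsto_intros]:
  fixes A :: "_ \<Rightarrow> real^'n^'m"
  assumes "(A \<longlongrightarrow> B) G"
  shows "((\<lambda>k. transpose (A k)) \<longlongrightarrow> transpose B) G"
proof -
  have "linear (transpose :: real^'n^'m \<Rightarrow> _)"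
    by (rule linearI) (auto simp: transpose_def vec_eq_iff)
  then have "bounded_linear (transpose :: real^'n^'m \<Rightarrow> _)"
    by (simp add: linear_conv_bounded_linear)
  then show ?thesis using assms by (rule bounded_linear.tendsto)
qed

lemma transpose_add: "transpose (A + B) = transpose A + transpose B"
  for A B :: "real^'n^'m"
  by (simp add: transpose_def vec_eq_iff)

lemma transpose_diff: "transpose (A - B) = transpose A - transpose B"
  for A B :: "real^'n^'m"
  by (simp add: transpose_def vec_eq_iff)

lemma inner_transpose_mult: "(transpose A *v x) \<bullet> y = x \<bullet> (A *v y)"
  for A :: "real^'n^'m"
  by (simp add: dot_lmul_matrix)

lemma linear_rge_map: "linear (\<lambda>w. (Y *v w, X *v w))"
  for Y X :: "real^'n^'n"
  by (rule linearI) (auto simp: matrix_vector_right_distrib matrix_vector_mult_scaleR)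

lemma subspace_rge: "subspace (rge Y X)"
  unfolding rge_def by (rule linear_subspace_image[OF linear_rge_map subspace_UNIV])

lemma inj_rge_map:
  fixes Y X :: "real^'n^'n"
  assumes "\<And>w. Y *v w = 0 \<Longrightarrow> X *v w = 0 \<Longrightarrow> w = 0"
  shows "inj (\<lambda>w. (Y *v w, X *v w))"
  unfolding linear_injective_0[OF linear_rge_map]
proof (intro allI impI)
  fix w assume "(Y *v w, X *v w) = 0"
  then show "w = 0" using assms by (simp add: prod_eq_iff)
qed

lemma rge_in_Zn:
  fixes Y X :: "real^'n^'n"
  assumes "\<And>w. Y *v w = 0 \<Longrightarrow> X *v w = 0 \<Longrightarrow> w = 0"
  shows "rge Y X \<in> Zn"
proof -
  have "inj (\<lambda>w. (Y *v w, X *v w))"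
    using assms by (rule inj_rge_map)
  then have "dim (rge Y X) = DIM(real^'n)"
    unfolding rge_def using dim_image_eq[OF linear_rge_map, of Y X UNIV] by simp
  then show ?thesis by (simp add: Zn_def subspace_rge)
qed

text \<open>An injective linear parametrization is bounded below by some c, so perturbing it by e
  moves a point z of the range by at most a multiple of (e / c) times norm z, in both directions.
  Without injectivity the dimension could drop in the limit.\<close>

lemma rge_tendsto:
  fixes Y X :: "real^'n^'n"
  assumes inj: "\<And>w. Y *v w = 0 \<Longrightarrow> X *v w = 0 \<Longrightarrow> w = 0"
    and Y: "Yk \<longlonglongrightarrow> Y" and X: "Xk \<longlonglongrightarrow> X"
  shows "(\<lambda>k. Zn_dist (rge (Yk k) (Xk k)) (rge Y X)) \<longlonglongrightarrow> 0"
proof -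
  define f where "f Y X w = (Y *v w, X *v w)" for Y X :: "real^'n^'n" and w
  have "inj (f Y X)"
    unfolding f_def using inj by (rule inj_rge_map)
  moreover have "linear (f Y X)"
    unfolding f_def by (rule linear_rge_map)
  ultimately obtain c where c: "c > 0" "\<And>w. c * norm w \<le> norm (f Y X w)"
    using linear_inj_bounded_below_pos by blast
  obtain K where K: "K > 0" "\<And>(A::real^'n^'n) (w::real^'n). norm (A *v w) \<le> norm A * norm w * K"
    using bounded_bilinear.pos_bounded[OF bounded_bilinear_matrix_vector_mult] by metis
  define e where "e k = (norm (Yk k - Y) + norm (Xk k - X)) * K" for k
  have e0: "e \<longlonglongrightarrow> 0"
  proof -
    have "(\<lambda>k. norm (Yk k - Y)) \<longlonglongrightarrow> 0" "(\<lambda>k. norm (Xk k - X)) \<longlonglongrightarrow> 0"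
      using X Y by (simp_all add: tendsto_norm_zero LIM_zero)
    then show ?thesis unfolding e_def by (intro tendsto_mult_left_zero tendsto_add_zero)
  qed
  have e_nonneg: "e k \<ge> 0" for k using K by (simp add: e_def)
  have fdiff: "norm (f (Yk k) (Xk k) w - f Y X w) \<le> e k * norm w" for k w
  proof -
    have "norm (f (Yk k) (Xk k) w - f Y X w) = norm ((Yk k - Y) *v w, (Xk k - X) *v w)"
      by (simp add: f_def matrix_vector_mult_diff_rdistrib)
    also have "\<dots> \<le> norm ((Yk k - Y) *v w) + norm ((Xk k - X) *v w)" by (rule norm_Pair_le)
    also have "\<dots> \<le> norm (Yk k - Y) * norm w * K + norm (Xk k - X) * norm w * K"
      by (intro add_mono K)
    finally show ?thesis by (simp add: e_def algebra_simps)
  qed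
  \<comment> \<open>For \<open>e k \<le> c / 2\<close> the perturbed map is still bounded below by c
    / 2, whence the inner factor 2; the outer one is that of \<open>Zn_dist_le\<close>.\<close>
  have bound: "Zn_dist (rge (Yk k) (Xk k)) (rge Y X) \<le> 2 * (2 * e k / c)" if "e k \<le> c / 2" for k
  proof (rule Zn_dist_le[OF subspace_rge subspace_rge])
    show "0 \<le> 2 * e k / c" using e_nonneg c by simp
  next
    fix z assume "z \<in> rge (Yk k) (Xk k)"
    then obtain w where w: "z = f (Yk k) (Xk k) w" by (auto simp: rge_def f_def)
    have "norm (f Y X w) \<le> norm (f (Yk k) (Xk k) w) + norm (f (Yk k) (Xk k) w - f Y X w)"
      by norm
    then have "c * norm w \<le> norm z + e k * norm w" using c(2)[of w] fdiff[of k w] w by simp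
    also have "e k * norm w \<le> c / 2 * norm w" using that by (intro mult_right_mono) auto
    finally have "norm w \<le> 2 * norm z / c" using c by (simp add: field_simps)
    then have "e k * norm w \<le> e k * (2 * norm z / c)" using e_nonneg by (intro mult_left_mono) auto
    then have "norm (z - f Y X w) \<le> 2 * e k / c * norm z"
      using fdiff[of k w] w by (simp add: mult_ac)
    then show "\<exists>p\<in>rge Y X. norm (z - p) \<le> 2 * e k / c * norm z" by (auto simp: rge_def f_def)
  next
    fix z assume "z \<in> rge Y X"
    then obtain w where w: "z = f Y X w" by (auto simp: rge_def f_def)
    have "norm w \<le> norm z / c" using c(2)[of w] c w by (simp add: field_simps)
    also have "\<dots> \<le> 2 * norm z / c" using c by (simp add: field_simps)
    finally have "e k * norm w \<le> e k * (2 * norm z / c)" using e_nonneg by (intro mult_left_mono) auto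
    then have "norm (z - f (Yk k) (Xk k) w) \<le> 2 * e k / c * norm z"
      using fdiff[of k w] w by (simp add: mult_ac norm_minus_commute)
    then show "\<exists>p\<in>rge (Yk k) (Xk k). norm (z - p) \<le> 2 * e k / c * norm z"
      by (auto simp: rge_def f_def)
  qed
  have "\<forall>\<^sub>F k in sequentially. e k < c / 2" using e0 c by (intro order_tendstoD) auto
  then have "\<forall>\<^sub>F k in sequentially. norm (Zn_dist (rge (Yk k) (Xk k)) (rge Y X)) \<le> 2 * (2 * e k / c)"
  proof eventually_elim
    case (elim k)
    then show ?case
      using bound[of k] Zn_dist_nonneg[OF subspace_rge subspace_rge, of "Yk k" "Xk k" Y X] by simp
  qed
  moreover have "(\<lambda>k. 2 * (2 * e k / c)) \<longlonglongrightarrow> 0"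
    using tendsto_mult_right_zero[OF e0, of "4 / c"] by simp
  ultimately show ?thesis by (rule Lim_null_comparison)
qed

text \<open>With B the derivative of the resolvent and M that of F, the range inside
  \<open>adj\<close> is the tangent space of the graph of F + \<Phi>; M = 0 gives \<Phi> alone.
  Orthogonality to it is the single equation \<open>perp\<close>, whose solutions the right-hand
  range parametrizes.\<close>

lemma adj_rge:
  fixes B M :: "real^'n^'n"
  assumes "\<gamma> > 0"
  shows "adj (rge B (\<gamma> *\<^sub>R (mat 1 - B) + M ** B)) =
    rge (transpose B) (\<gamma> *\<^sub>R (mat 1 - transpose B) + transpose M ** transpose B)"
    (is "adj ?T = ?R")
proof -
  let ?B = "transpose B" and ?M = "transpose M"
  have perp: "(u, v) \<in> ?T\<^sup>\<bottom> \<longleftrightarrow> ?B *v u + \<gamma> *\<^sub>R (v - ?B *v v) + ?B *v (?M *v v) = 0" for u v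
  proof -
    have "(B *v h) \<bullet> u + ((\<gamma> *\<^sub>R (mat 1 - B) + M ** B) *v h) \<bullet> v
        = h \<bullet> (?B *v u + \<gamma> *\<^sub>R (v - ?B *v v) + ?B *v (?M *v v))" for h
    proof -
      have 1: "a \<bullet> (?B *v w) = (B *v a) \<bullet> w" for a w
        by (metis inner_commute inner_transpose_mult)
      have 2: "a \<bullet> (?M *v w) = (M *v a) \<bullet> w" for a w
        by (metis inner_commute inner_transpose_mult)
      show ?thesis
        by (simp only: inner_add_right inner_diff_right inner_scaleR_right 1 2
            matrix_vector_mult_add_rdistrib matrix_vector_mult_diff_rdistrib matrix_vector_mul_lid
            matrix_vector_mul_assoc[symmetric] scaleR_matrix_vector_assoc[symmetric]
            inner_add_left inner_diff_left inner_scaleR_left)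
    qed
    then have "(u, v) \<in> ?T\<^sup>\<bottom> \<longleftrightarrow>
        (\<forall>h. h \<bullet> (?B *v u + \<gamma> *\<^sub>R (v - ?B *v v) + ?B *v (?M *v v)) = 0)"
      by (auto simp: orthogonal_comp_def orthogonal_def rge_def)
    then show ?thesis using vector_eq_ldot[of "?B *v u + \<gamma> *\<^sub>R (v - ?B *v v) + ?B *v (?M *v v)" 0]
      by auto
  qed
  show ?thesis
  proof (intro set_eqI iffI)
    fix p assume "p \<in> adj ?T"
    then obtain u v where uv: "p = (- v, u)" "(u, v) \<in> ?T\<^sup>\<bottom>" by (auto simp: adj_def)
    \<comment> \<open>Found by solving the second component u = \<gamma> h - \<gamma> B^T h + M^T
      B^T h for \<open>h\<close> after inserting B^T h = - v.\<close>
    define h where "h = (1 / \<gamma>) *\<^sub>R (u + ?M *v v - \<gamma> *\<^sub>R v)"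
    have gh: "\<gamma> *\<^sub>R h = u + ?M *v v - \<gamma> *\<^sub>R v" using assms by (simp add: h_def)
    have "\<gamma> *\<^sub>R (?B *v h) = ?B *v (u + ?M *v v - \<gamma> *\<^sub>R v)"
      by (metis gh matrix_vector_mult_scaleR)
    also have "\<dots> = \<gamma> *\<^sub>R (- v)"
      using uv(2)[unfolded perp]
      by (simp add: algebra_simps del: transpose_matrix_vector)
    finally have Bh: "?B *v h = - v" using assms by (metis less_irrefl scaleR_left_imp_eq)
    have "(\<gamma> *\<^sub>R (mat 1 - ?B) + ?M ** ?B) *v h = \<gamma> *\<^sub>R h - \<gamma> *\<^sub>R (?B *v h) + ?M *v (?B *v h)"
      by (simp add: matrix_vector_mult_add_rdistrib matrix_vector_mult_diff_rdistrib
          matrix_vector_mul_assoc[symmetric] scaleR_matrix_vector_assoc[symmetric]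
          scaleR_diff_right del: transpose_matrix_vector)
    also have "\<dots> = u"
      by (simp only: Bh gh) (simp add: matrix_vector_mult_minus_right del: transpose_matrix_vector)
    finally show "p \<in> ?R" using Bh uv(1)
      by (auto simp: rge_def intro!: image_eqI[of _ _ h] simp del: transpose_matrix_vector)
  next
    fix p assume "p \<in> ?R"
    then obtain h where p: "p = (?B *v h, (\<gamma> *\<^sub>R (mat 1 - ?B) + ?M ** ?B) *v h)"
      by (auto simp: rge_def simp del: transpose_matrix_vector)
    have "(snd p, - fst p) \<in> ?T\<^sup>\<bottom>"
      unfolding perp p
      by (simp add: matrix_vector_mul_assoc[symmetric] scaleR_matrix_vector_assoc[symmetric]
          matrix_vector_mult_minus_right algebra_simps del: transpose_matrix_vector)
    then show "p \<in> adj ?T" by (force simp: adj_def)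
  qed
qed

subsection \<open>Contingent cones of graphs\<close>

text \<open>The directions \<open>W k\<close> may vary: they are bounded, so the Frechet remainder
  is o(t k), and f' is continuous. Varying directions are exactly what sequences in a contingent
  cone provide.\<close>

lemma has_derivative_sequentially:
  fixes f :: "'a::real_normed_vector \<Rightarrow> 'b::real_normed_vector"
  assumes f: "(f has_derivative f') (at x)"
    and t: "\<And>k::nat. t k > 0" "t \<longlonglongrightarrow> 0" and W: "W \<longlonglongrightarrow> w"
  shows "(\<lambda>k. (1 / t k) *\<^sub>R (f (x + t k *\<^sub>R W k) - f x)) \<longlonglongrightarrow> f' w"
proof -
  have f': "bounded_linear f'" using f by (rule has_derivative_bounded_linear)
  obtain C where C: "C > 0" "\<And>k. norm (W k) \<le> C"
    using convergent_imp_Bseq[OF convergentI[OF W]] by (auto elim: BseqE)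
  have tW: "(\<lambda>k. t k *\<^sub>R W k) \<longlonglongrightarrow> 0"
    using tendsto_scaleR[OF t(2) W] by simp
  have "(\<lambda>k. (1 / t k) *\<^sub>R (f (x + t k *\<^sub>R W k) - f x) - f' (W k)) \<longlonglongrightarrow> 0"
  proof (rule LIMSEQ_I)
    fix r :: real assume "r > 0"
    define e where "e = r / (2 * C)"
    have "e > 0" using \<open>r > 0\<close> C by (simp add: e_def)
    then obtain d where d: "d > 0"
      "\<And>y. norm (y - x) < d \<Longrightarrow> norm (f y - f x - f' (y - x)) \<le> e * norm (y - x)"
      using f unfolding has_derivative_at_alt by blast
    obtain N where N: "\<And>k. k \<ge> N \<Longrightarrow> norm (t k *\<^sub>R W k) < d"
      using LIMSEQ_D[OF tW d(1)] by auto
    show "\<exists>no. \<forall>n\<ge>no. norm ((1 / t n) *\<^sub>R (f (x + t n *\<^sub>R W n) - f x) - f' (W n) - 0) < r"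
    proof (intro exI allI impI)
      fix n assume "n \<ge> N"
      have "norm (f (x + t n *\<^sub>R W n) - f x - t n *\<^sub>R f' (W n)) \<le> e * norm (t n *\<^sub>R W n)"
        using d(2)[of "x + t n *\<^sub>R W n"] N[OF \<open>n \<ge> N\<close>]
        by (simp add: linear_simps(5)[OF f'])
      also have "\<dots> \<le> e * (t n * C)"
        using C \<open>e > 0\<close> t(1)[of n] by (simp add: mult_left_mono)
      also have "\<dots> = t n * (r / 2)" using C by (simp add: e_def)
      finally have le: "norm (f (x + t n *\<^sub>R W n) - f x - t n *\<^sub>R f' (W n)) \<le> t n * (r / 2)" .
      have "(1 / t n) *\<^sub>R (f (x + t n *\<^sub>R W n) - f x) - f' (W n)
          = (1 / t n) *\<^sub>R (f (x + t n *\<^sub>R W n) - f x - t n *\<^sub>R f' (W n))"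
        using t(1)[of n] by (simp add: scaleR_diff_right)
      then have "norm ((1 / t n) *\<^sub>R (f (x + t n *\<^sub>R W n) - f x) - f' (W n)) \<le> r / 2"
        using le t(1)[of n] by (simp add: divide_simps mult.commute)
      then show "norm ((1 / t n) *\<^sub>R (f (x + t n *\<^sub>R W n) - f x) - f' (W n) - 0) < r"
        using \<open>r > 0\<close> by simp
    qed
  qed
  moreover have "(\<lambda>k. f' (W k)) \<longlonglongrightarrow> f' w" using f' W by (rule bounded_linear.tendsto)
  ultimately show ?thesis using tendsto_add by fastforce
qed

text \<open>The differentiable left inverse \<open>\<sigma>\<close> turns a tangent sequence in the
  range into convergent parameter directions, and the derivative of \<open>\<Psi>\<close> carries
  their limit to the tangent. Without it, points of the range near \<open>\<Psi> z\<close> could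
  come from remote parameters.\<close>

lemma contingent_cone_range:
  fixes \<Psi> :: "'a::real_normed_vector \<Rightarrow> 'b::real_normed_vector"
  assumes inverse: "\<And>z. \<sigma> (\<Psi> z) = z"
    and \<Psi>: "(\<Psi> has_derivative \<Psi>') (at z)" and \<sigma>: "(\<sigma> has_derivative \<sigma>') (at (\<Psi> z))"
  shows "contingent_cone (range \<Psi>) (\<Psi> z) = range \<Psi>'"
proof (intro set_eqI iffI)
  fix w assume "w \<in> contingent_cone (range \<Psi>) (\<Psi> z)"
  then obtain t :: "nat \<Rightarrow> real" and W where t: "\<And>k. t k > 0" "t \<longlonglongrightarrow> 0" and W: "W \<longlonglongrightarrow> w"
    and mem: "\<And>k. \<Psi> z + t k *\<^sub>R W k \<in> range \<Psi>"
    unfolding contingent_cone_def by auto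
  define H where "H k = (1 / t k) *\<^sub>R (\<sigma> (\<Psi> z + t k *\<^sub>R W k) - \<sigma> (\<Psi> z))" for k
  have "H \<longlonglongrightarrow> \<sigma>' w"
    unfolding H_def using \<sigma> t W by (rule has_derivative_sequentially)
  then have "(\<lambda>k. (1 / t k) *\<^sub>R (\<Psi> (z + t k *\<^sub>R H k) - \<Psi> z)) \<longlonglongrightarrow> \<Psi>' (\<sigma>' w)"
    using has_derivative_sequentially[OF \<Psi> t] by blast
  moreover have "(1 / t k) *\<^sub>R (\<Psi> (z + t k *\<^sub>R H k) - \<Psi> z) = W k" for k
  proof -
    obtain y where y: "\<Psi> z + t k *\<^sub>R W k = \<Psi> y" using mem[of k] by auto
    have "z + t k *\<^sub>R H k = y" using t(1)[of k] by (simp add: H_def y inverse)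
    then have "\<Psi> (z + t k *\<^sub>R H k) = \<Psi> z + t k *\<^sub>R W k" using y by simp
    then show ?thesis using t(1)[of k] by simp
  qed
  ultimately have "W \<longlonglongrightarrow> \<Psi>' (\<sigma>' w)" by simp
  then have "w = \<Psi>' (\<sigma>' w)" using W LIMSEQ_unique by blast
  then show "w \<in> range \<Psi>'" by (rule range_eqI)
next
  fix w assume "w \<in> range \<Psi>'"
  then obtain h where h: "w = \<Psi>' h" by auto
  define t where "t k = inverse (real (Suc k))" for k
  have t: "\<And>k. t k > 0" "t \<longlonglongrightarrow> 0"
    unfolding t_def using LIMSEQ_inverse_real_of_nat by auto
  define W where "W k = (1 / t k) *\<^sub>R (\<Psi> (z + t k *\<^sub>R h) - \<Psi> z)" for k
  have "W \<longlonglongrightarrow> w"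
    unfolding W_def h using has_derivative_sequentially[OF \<Psi> t tendsto_const] .
  moreover have "\<Psi> z + t k *\<^sub>R W k \<in> range \<Psi>" for k
    using t(1)[of k] by (simp add: W_def)
  ultimately show "w \<in> contingent_cone (range \<Psi>) (\<Psi> z)"
    unfolding contingent_cone_def using t by blast
qed

subsection \<open>Bouligand subdifferential of a nonexpansive map\<close>

lemma norm_has_derivative_le:
  fixes f :: "'a::real_normed_vector \<Rightarrow> 'b::real_normed_vector"
  assumes "(f has_derivative f') (at x)" "\<And>a b. norm (f a - f b) \<le> norm (a - b)"
  shows "norm (f' h) \<le> norm h"
proof -
  define t where "t k = inverse (real (Suc k))" for k
  have t: "\<And>k. t k > 0" "t \<longlonglongrightarrow> 0"
    unfolding t_def using LIMSEQ_inverse_real_of_nat by auto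
  have "(\<lambda>k. (1 / t k) *\<^sub>R (f (x + t k *\<^sub>R h) - f x)) \<longlonglongrightarrow> f' h"
    using has_derivative_sequentially[OF assms(1) t tendsto_const] .
  then have "(\<lambda>k. norm ((1 / t k) *\<^sub>R (f (x + t k *\<^sub>R h) - f x))) \<longlonglongrightarrow> norm (f' h)"
    by (rule tendsto_norm)
  moreover have "norm ((1 / t k) *\<^sub>R (f (x + t k *\<^sub>R h) - f x)) \<le> norm h" for k
    using assms(2)[of "x + t k *\<^sub>R h" x] t(1)[of k] by (simp add: divide_simps mult.commute)
  ultimately show ?thesis by (meson LIMSEQ_le_const2)
qed

text \<open>Contains all Jacobians of a nonexpansive map, so sequences of them have convergent
  subsequences.\<close>

lemma compact_nonexpansive_matrices:
  "compact {B :: real^'n^'m. \<forall>h. norm (B *v h) \<le> norm h}"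
proof (rule compact_eq_bounded_closed[THEN iffD2], intro conjI)
  show "bounded {B :: real^'n^'m. \<forall>h. norm (B *v h) \<le> norm h}"
  proof (rule boundedI)
    fix B :: "real^'n^'m" assume "B \<in> {B. \<forall>h. norm (B *v h) \<le> norm h}"
    then have "onorm ((*v) B) \<le> 1" by (intro onorm_bound) auto
    then have "\<bar>B $ i $ j\<bar> \<le> 1" for i j
      using matrix_component_le_onorm[of B i j] by simp
    then have "(\<Sum>j\<in>UNIV. \<bar>B $ i $ j\<bar>) \<le> real CARD('n)" for i
      using sum_bounded_above[of UNIV "\<lambda>j. \<bar>B $ i $ j\<bar>" 1] by simp
    then have "norm (B $ i) \<le> real CARD('n)" for i
      using norm_le_l1_cart order_trans by blast
    then have "(\<Sum>i\<in>UNIV. norm (B $ i)) \<le> (\<Sum>i\<in>(UNIV::'m set). real CARD('n))"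
      by (intro sum_mono)
    moreover have "norm B \<le> (\<Sum>i\<in>UNIV. norm (B $ i))"
      unfolding norm_vec_def[of B] by (rule L2_set_le_sum) simp
    ultimately have "norm B \<le> (\<Sum>i\<in>(UNIV::'m set). real CARD('n))" by linarith
    then show "norm B \<le> real CARD('m) * real CARD('n)" by simp
  qed
  have "closed {B :: real^'n^'m. norm (B *v h) \<le> norm h}" for h
  proof (rule closed_Collect_le)
    show "continuous_on UNIV (\<lambda>B::real^'n^'m. norm (B *v h))"
      by (intro continuous_on_norm linear_continuous_on
          bounded_bilinear.bounded_linear_left[OF bounded_bilinear_matrix_vector_mult])
  qed simp
  then show "closed {B :: real^'n^'m. \<forall>h. norm (B *v h) \<le> norm h}"
    by (rule closed_Collect_all)
qed

lemma bouligand_subdiff_nonexpansive: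
  fixes J :: "real^'n \<Rightarrow> real^'n"
  assumes "\<And>a b. norm (J a - J b) \<le> norm (a - b)" and "B \<in> bouligand_subdiff J z"
  shows "norm (B *v h) \<le> norm h"
proof -
  obtain Z where "\<And>k. J differentiable at (Z k)" and lim: "(\<lambda>k::nat. jacobian J (at (Z k))) \<longlonglongrightarrow> B"
    using assms(2) by (auto simp: bouligand_subdiff_def)
  then have "norm (jacobian J (at (Z k)) *v h) \<le> norm h" for k
    using assms(1) jacobian_works norm_has_derivative_le by blast
  moreover have "(\<lambda>k. norm (jacobian J (at (Z k)) *v h)) \<longlonglongrightarrow> norm (B *v h)"
    using lim by (intro tendsto_intros)
  ultimately show ?thesis by (meson LIMSEQ_le_const2)
qed

text \<open>In this form the closedness of the graph of the Bouligand subdifferential is that of a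
  closure, and no diagonal sequences are needed.\<close>

lemma bouligand_subdiff_iff_closure:
  "B \<in> bouligand_subdiff \<Psi> z \<longleftrightarrow>
    (z, B) \<in> closure {(y, jacobian \<Psi> (at y)) | y. \<Psi> differentiable at y}"
  (is "_ \<longleftrightarrow> _ \<in> closure ?S")
proof
  assume "B \<in> bouligand_subdiff \<Psi> z"
  then obtain Z where Z: "Z \<longlonglongrightarrow> z" "\<And>k::nat. \<Psi> differentiable at (Z k)"
    "(\<lambda>k. jacobian \<Psi> (at (Z k))) \<longlonglongrightarrow> B"
    by (auto simp: bouligand_subdiff_def)
  then have "(\<lambda>k. (Z k, jacobian \<Psi> (at (Z k)))) \<longlonglongrightarrow> (z, B)"
    by (intro tendsto_Pair)
  then show "(z, B) \<in> closure ?S"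
    unfolding closure_sequential using Z(2)
    by (intro exI[of _ "\<lambda>k. (Z k, jacobian \<Psi> (at (Z k)))"]) auto
next
  assume "(z, B) \<in> closure ?S"
  then obtain p where p: "\<And>k::nat. p k \<in> ?S" "p \<longlonglongrightarrow> (z, B)"
    unfolding closure_sequential by auto
  have "\<Psi> differentiable at (fst (p k))" "snd (p k) = jacobian \<Psi> (at (fst (p k)))" for k
    using p(1)[of k] by auto
  moreover have "(\<lambda>k. fst (p k)) \<longlonglongrightarrow> z" "(\<lambda>k. snd (p k)) \<longlonglongrightarrow> B"
    using tendsto_fst[OF p(2)] tendsto_snd[OF p(2)] by simp_all
  ultimately show "B \<in> bouligand_subdiff \<Psi> z"
    unfolding bouligand_subdiff_def by auto
qed

lemma bouligand_subdiff_closed: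
  fixes \<Psi> :: "real^'n \<Rightarrow> real^'n"
  assumes "\<And>k::nat. Bk k \<in> bouligand_subdiff \<Psi> (Z k)" "Z \<longlonglongrightarrow> z" "Bk \<longlonglongrightarrow> B"
  shows "B \<in> bouligand_subdiff \<Psi> z"
  unfolding bouligand_subdiff_iff_closure
  using closed_sequentially[OF closed_closure
      assms(1)[unfolded bouligand_subdiff_iff_closure] tendsto_Pair[OF assms(2,3)]] .

subsection \<open>SCD derivatives of maps with a nonexpansive resolvent\<close>

text \<open>\<open>J\<close> is the resolvent of \<open>\<Phi>\<close>, the inverse of I + \<Phi> /
  c, and \<open>gph_eq\<close> is the Minty parametrization of the graph: the parameter of (x, y) is
  x + y / c. The constant stays free because it is taken as \<gamma> for the comparison with
  Algorithm B and as 1 for convergence.\<close>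

locale nonexpansive_resolvent =
  fixes \<Phi> :: "real^'n \<Rightarrow> (real^'n) set" and J :: "real^'n \<Rightarrow> real^'n" and c :: real
  assumes c_pos: "c > 0"
    and gph_eq: "gph \<Phi> = range (\<lambda>z. (J z, c *\<^sub>R (z - J z)))"
    and nonexpansive: "norm (J a - J b) \<le> norm (a - b)"
begin

text \<open>Tangents to the graph of \<open>\<Phi>\<close> correspond to limits of difference quotients of \<open>J\<close>
  through \<open>(a, b) \<mapsto> (a + b / c, a)\<close>.\<close>

lemma contingent_cone_norm_le:
  assumes "(a, b) \<in> contingent_cone (gph \<Phi>) (J z, c *\<^sub>R (z - J z))"
  shows "norm a \<le> norm (a + (1 / c) *\<^sub>R b)"
proof -
  obtain t :: "nat \<Rightarrow> real" and W where t: "\<And>k. t k > 0" and W: "W \<longlonglongrightarrow> (a, b)"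
    and mem: "\<And>k. (J z, c *\<^sub>R (z - J z)) + t k *\<^sub>R W k \<in> gph \<Phi>"
    using assms unfolding contingent_cone_def by auto
  have le: "norm (fst (W k)) \<le> norm (fst (W k) + (1 / c) *\<^sub>R snd (W k))" for k
  proof -
    obtain y where y: "J z + t k *\<^sub>R fst (W k) = J y"
      "c *\<^sub>R (z - J z) + t k *\<^sub>R snd (W k) = c *\<^sub>R (y - J y)"
      using mem[of k] unfolding gph_eq by (auto simp: prod_eq_iff)
    have "(1 / c) *\<^sub>R (c *\<^sub>R (z - J z) + t k *\<^sub>R snd (W k)) = y - J y"
      using c_pos by (simp add: y(2))
    then have "y - J y = (z - J z) + t k *\<^sub>R ((1 / c) *\<^sub>R snd (W k))"
      using c_pos by (simp add: scaleR_add_right)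
    moreover have "J y - J z = t k *\<^sub>R fst (W k)" using y(1)[symmetric] by simp
    moreover have "y - z = (y - J y) + (J y - J z) - (z - J z)" by simp
    ultimately have yz: "y - z = t k *\<^sub>R (fst (W k) + (1 / c) *\<^sub>R snd (W k))"
      by (simp add: scaleR_add_right)
    have "norm (t k *\<^sub>R fst (W k)) = norm (J y - J z)" using y(1)[symmetric] by simp
    also have "\<dots> \<le> norm (y - z)" by (rule nonexpansive)
    finally have "t k * norm (fst (W k)) \<le> t k * norm (fst (W k) + (1 / c) *\<^sub>R snd (W k))"
      using t[of k] unfolding yz by simp
    then show ?thesis using t[of k] by simp
  qed
  have "(\<lambda>k. fst (W k)) \<longlonglongrightarrow> a" "(\<lambda>k. snd (W k)) \<longlonglongrightarrow> b"
    using tendsto_fst[OF W] tendsto_snd[OF W] by simp_all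
  then have "(\<lambda>k. fst (W k) + (1 / c) *\<^sub>R snd (W k)) \<longlonglongrightarrow> a + (1 / c) *\<^sub>R b"
    by (intro tendsto_intros)
  then have "(\<lambda>k. norm (fst (W k) + (1 / c) *\<^sub>R snd (W k))) \<longlonglongrightarrow> norm (a + (1 / c) *\<^sub>R b)"
    by (rule tendsto_norm)
  moreover have "(\<lambda>k. norm (fst (W k))) \<longlonglongrightarrow> norm a"
    using \<open>(\<lambda>k. fst (W k)) \<longlonglongrightarrow> a\<close> by (rule tendsto_norm)
  ultimately show ?thesis using le by (meson LIMSEQ_le)
qed

text \<open>The chosen \<open>W\<close> is the exact difference quotient of the Minty
  parametrization, so the points stay in the graph. This makes every cluster point of difference
  quotients of \<open>J\<close> the first component of a tangent.\<close>

lemma contingent_cone_memI: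
  assumes t: "\<And>k::nat. t k > 0" "t \<longlonglongrightarrow> 0" and H: "H \<longlonglongrightarrow> h"
    and a: "(\<lambda>k. (1 / t k) *\<^sub>R (J (z + t k *\<^sub>R H k) - J z)) \<longlonglongrightarrow> a"
  shows "(a, c *\<^sub>R (h - a)) \<in> contingent_cone (gph \<Phi>) (J z, c *\<^sub>R (z - J z))"
proof -
  define A where "A k = (1 / t k) *\<^sub>R (J (z + t k *\<^sub>R H k) - J z)" for k
  define W where "W k = (A k, c *\<^sub>R (H k - A k))" for k
  have "A \<longlonglongrightarrow> a" using a by (simp add: A_def[abs_def])
  then have W: "W \<longlonglongrightarrow> (a, c *\<^sub>R (h - a))"
    unfolding W_def using H by (intro tendsto_intros)
  have "(J z, c *\<^sub>R (z - J z)) + t k *\<^sub>R W k \<in> gph \<Phi>" for k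
  proof -
    define y where "y = z + t k *\<^sub>R H k"
    have tA: "t k *\<^sub>R A k = J y - J z" using t(1)[of k] by (simp add: A_def y_def)
    have "t k *\<^sub>R (c *\<^sub>R (H k - A k)) = c *\<^sub>R (t k *\<^sub>R H k - t k *\<^sub>R A k)"
      by (simp add: algebra_simps)
    also have "\<dots> = c *\<^sub>R (y - J y) - c *\<^sub>R (z - J z)"
      unfolding tA by (simp add: y_def algebra_simps)
    finally have "(J z, c *\<^sub>R (z - J z)) + t k *\<^sub>R W k = (J y, c *\<^sub>R (y - J y))"
      using tA by (simp add: W_def)
    then show ?thesis unfolding gph_eq by blast
  qed
  then show ?thesis unfolding contingent_cone_def using t W by blast
qed

text \<open>By the norm inequality, (a, b) \<mapsto> a + b / c is injective on the cone, and the
  dimension makes it onto. So exactly one tangent lies over each direction h, of the form (b h, c (h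
  - b h)) with \<open>b\<close> linear. Cluster points of difference quotients of \<open>J\<close>
  in direction h come from tangents over h, hence equal b h, which by compactness is
  differentiability.\<close>

lemma contingent_cone_in_Zn:
  assumes Zn: "contingent_cone (gph \<Phi>) (J z, c *\<^sub>R (z - J z)) \<in> Zn"
  shows "J differentiable (at z)"
    and "contingent_cone (gph \<Phi>) (J z, c *\<^sub>R (z - J z)) =
      rge (jacobian J (at z)) (c *\<^sub>R (mat 1 - jacobian J (at z)))"
proof -
  define T where "T = contingent_cone (gph \<Phi>) (J z, c *\<^sub>R (z - J z))"
  define \<phi> where "\<phi> p = fst p + (1 / c) *\<^sub>R snd p" for p :: "(real^'n) \<times> (real^'n)"
  have subspace: "subspace T" and dim: "dim T = DIM(real^'n)"
    using Zn by (auto simp: Zn_def T_def)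
  have norm_le: "norm (fst p) \<le> norm (\<phi> p)" if "p \<in> T" for p
    using contingent_cone_norm_le[of "fst p" "snd p"] that by (simp add: T_def \<phi>_def)
  have lin: "linear \<phi>"
    by (rule linearI) (auto simp: \<phi>_def scaleR_add_right)
  have inj: "inj_on \<phi> T"
  proof -
    have "p = 0" if p: "p \<in> T" "\<phi> p = 0" for p
    proof -
      have "fst p = 0" using norm_le[OF p(1)] p(2) by simp
      then have "snd p = 0" using p(2) c_pos by (simp add: \<phi>_def)
      then show ?thesis using \<open>fst p = 0\<close> by (simp add: prod_eq_iff)
    qed
    then show ?thesis using linear_inj_on_iff_eq_0[OF lin subspace] by auto
  qed
  have "inj_on \<phi> (span T)" using inj span_eq_iff[THEN iffD2, OF subspace] by metis
  then have "dim (\<phi> ` T) = DIM(real^'n)"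
    using dim_image_eq[OF lin, of T] dim by simp
  then have surj: "\<phi> ` T = UNIV"
    using linear_subspace_image[OF lin subspace] dim_eq_full[of "\<phi> ` T"]
    by (metis span_eq_iff)
  define \<psi> where "\<psi> = inv_into T \<phi>"
  have \<psi>: "\<psi> h \<in> T" "\<phi> (\<psi> h) = h" for h
    unfolding \<psi>_def using surj by (auto intro: inv_into_into f_inv_into_f)
  have \<psi>_eq: "\<psi> h = p" if "p \<in> T" "\<phi> p = h" for h p
    unfolding \<psi>_def using that inj by (auto intro: inv_into_f_f)
  have \<psi>_lin: "linear \<psi>"
    by (rule linearI; rule \<psi>_eq)
      (simp_all add: \<psi> subspace subspace_add subspace_scale linear_add[OF lin] linear_cmul[OF lin])
  define b where "b h = fst (\<psi> h)" for h
  have b_lin: "linear b"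
    unfolding b_def using linear_compose[OF \<psi>_lin linear_fst] by (simp add: o_def)
  have \<psi>_b: "\<psi> h = (b h, c *\<^sub>R (h - b h))" for h
  proof -
    have "h - b h = \<phi> (\<psi> h) - fst (\<psi> h)" by (simp add: \<psi>(2) b_def)
    then have "c *\<^sub>R (h - b h) = snd (\<psi> h)" using c_pos by (simp add: \<phi>_def)
    then show ?thesis by (simp add: b_def prod_eq_iff)
  qed
  have unique: "a = b h" if "(a, c *\<^sub>R (h - a)) \<in> T" for a h
    using \<psi>_eq[OF that, of h] \<psi>_b[of h] c_pos by (simp add: \<phi>_def)
  have J_deriv: "(J has_derivative b) (at z)"
    unfolding has_derivative_at_alt
  proof (intro conjI allI impI)
    show "bounded_linear b" using b_lin by (simp add: linear_conv_bounded_linear)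
    fix e :: real assume "e > 0"
    show "\<exists>d>0. \<forall>y. norm (y - z) < d \<longrightarrow> norm (J y - J z - b (y - z)) \<le> e * norm (y - z)"
    proof (rule ccontr)
      assume "\<not> ?thesis"
      then have "\<forall>k. \<exists>y. norm (y - z) < inverse (real (Suc k)) \<and>
          e * norm (y - z) < norm (J y - J z - b (y - z))"
        by (metis inverse_positive_iff_positive not_le of_nat_0_less_iff zero_less_Suc)
      then obtain y where y: "\<And>k. norm (y k - z) < inverse (real (Suc k))"
        "\<And>k. e * norm (y k - z) < norm (J (y k) - J z - b (y k - z))"
        by metis
      \<comment> \<open>Normalized directions and quotients: both lie in the unit ball, the latter
        by nonexpansiveness, so a subsequence of the pairs converges.\<close>
      define t where "t k = norm (y k - z)" for k
      define H where "H k = (1 / t k) *\<^sub>R (y k - z)" for k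
      define A where "A k = (1 / t k) *\<^sub>R (J (y k) - J z)" for k
      have tpos: "t k > 0" for k
        using y(2)[of k] linear_0[OF b_lin] by (cases "y k = z") (auto simp: t_def)
      have t0: "t \<longlonglongrightarrow> 0"
        using y(1) LIMSEQ_inverse_real_of_nat
        by (intro tendsto_sandwich[OF _ _ tendsto_const LIMSEQ_inverse_real_of_nat])
          (auto simp: t_def intro!: always_eventually less_imp_le)
      have tH: "z + t k *\<^sub>R H k = y k" for k using tpos[of k] by (simp add: H_def)
      have "norm (H k) = 1" for k using tpos[of k] by (simp add: H_def t_def)
      moreover have "norm (A k) \<le> 1" for k
        using nonexpansive[of "y k" z] tpos[of k] by (simp add: A_def t_def)
      ultimately have HA: "\<forall>k. (H k, A k) \<in> cball 0 1 \<times> cball 0 1" by simp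
      have "seq_compact (cball (0::real^'n) 1 \<times> cball (0::real^'n) 1)"
        by (intro compact_imp_seq_compact compact_Times compact_cball)
      from seq_compactE[OF this HA] obtain l r where r: "strict_mono (r :: nat \<Rightarrow> nat)"
        and l: "((\<lambda>k. (H k, A k)) \<circ> r) \<longlonglongrightarrow> l"
        by blast
      define h a where "h = fst l" and "a = snd l"
      have Hr: "(\<lambda>k. H (r k)) \<longlonglongrightarrow> h" and Ar: "(\<lambda>k. A (r k)) \<longlonglongrightarrow> a"
        using tendsto_fst[OF l] tendsto_snd[OF l] by (simp_all add: h_def a_def)
      have tr: "(\<lambda>k. t (r k)) \<longlonglongrightarrow> 0" using LIMSEQ_subseq_LIMSEQ[OF t0 r] by (simp add: o_def)
      have "(a, c *\<^sub>R (h - a)) \<in> T"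
        unfolding T_def
        by (rule contingent_cone_memI[OF _ tr Hr]) (use tpos Ar tH in \<open>auto simp: A_def\<close>)
      then have "a = b h" by (rule unique)
      have "e \<le> norm (A k - b (H k))" for k
      proof -
        have "A k - b (H k) = (1 / t k) *\<^sub>R (J (y k) - J z - b (y k - z))"
          unfolding A_def H_def linear_cmul[OF b_lin] by (simp only: scaleR_diff_right)
        then have "norm (A k - b (H k)) = norm (J (y k) - J z - b (y k - z)) / t k"
          using tpos[of k] by (simp only: norm_scaleR) simp
        then show ?thesis
          using y(2)[of k] tpos[of k] by (simp only: t_def[symmetric]) (simp add: pos_le_divide_eq)
      qed
      moreover have "(\<lambda>k. norm (A (r k) - b (H (r k)))) \<longlonglongrightarrow> norm (a - b h)"
        using Ar linear_conv_bounded_linear[THEN iffD1, OF b_lin, THEN bounded_linear.tendsto, OF Hr]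
        by (intro tendsto_intros)
      ultimately have "e \<le> norm (a - b h)" by (meson LIMSEQ_le_const)
      then show False using \<open>a = b h\<close> \<open>e > 0\<close> by simp
    qed
  qed
  then show "J differentiable (at z)" by (auto simp: differentiable_def)
  have "b h = jacobian J (at z) *v h" for h
    unfolding jacobian_def frechet_derivative_at[OF J_deriv, symmetric]
    by (simp add: matrix_works linear_matrix_vector_mul_eq b_lin)
  moreover have "T = range \<psi>"
    using \<psi>_eq[OF _ refl] \<psi>(1) by (metis image_subset_iff rangeI subsetI subset_antisym)
  ultimately show "contingent_cone (gph \<Phi>) (J z, c *\<^sub>R (z - J z)) =
      rge (jacobian J (at z)) (c *\<^sub>R (mat 1 - jacobian J (at z)))"
    unfolding T_def[symmetric] rge_def
    by (simp add: \<psi>_b scaleR_matrix_vector_assoc[symmetric] matrix_vector_mult_diff_rdistrib)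
qed

text \<open>If B w = 0, the second component is c w. Hence these ranges are n-dimensional for every
  B and M, limits included.\<close>

lemma rge_parametrization_inj:
  fixes B M :: "real^'n^'n"
  assumes "B *v w = 0" "(c *\<^sub>R (mat 1 - B) + M ** B) *v w = 0"
  shows "w = 0"
  using assms c_pos
  by (simp add: matrix_vector_mult_add_rdistrib matrix_vector_mult_diff_rdistrib
      scaleR_matrix_vector_assoc[symmetric] matrix_vector_mul_assoc[symmetric])

text \<open>Along the defining sequence the subspaces are explicit in the Jacobians
  \<open>B k\<close>, which stay in a compact set. A subsequence limit \<open>B0\<close> yields an
  explicit limit subspace, and limits in the gap metric are unique.\<close>

lemma S_star_subset:
  assumes "L \<in> S_star \<Phi> (x, y)"
  obtains B where "B \<in> bouligand_subdiff J (x + (1 / c) *\<^sub>R y)"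
    and "L = rge (transpose B) (c *\<^sub>R (mat 1 - transpose B))"
proof -
  obtain P Lk where L: "L \<in> Zn" and P: "\<And>k::nat. P k \<in> gph \<Phi>" "P \<longlonglongrightarrow> (x, y)"
    and Lk: "\<And>k. Lk k \<in> S_hat \<Phi> (P k)" "(\<lambda>k. Zn_dist (Lk k) L) \<longlonglongrightarrow> 0"
    using assms unfolding S_star_def by auto
  define Z where "Z k = fst (P k) + (1 / c) *\<^sub>R snd (P k)" for k
  define B where "B k = jacobian J (at (Z k))" for k
  have PZ: "P k = (J (Z k), c *\<^sub>R (Z k - J (Z k)))" for k
  proof -
    obtain z where "P k = (J z, c *\<^sub>R (z - J z))" using P(1)[of k] gph_eq by auto
    moreover from this have "Z k = z" using c_pos by (simp add: Z_def)
    ultimately show ?thesis by simp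
  qed
  have "(\<lambda>k. fst (P k)) \<longlonglongrightarrow> x" "(\<lambda>k. snd (P k)) \<longlonglongrightarrow> y"
    using tendsto_fst[OF P(2)] tendsto_snd[OF P(2)] by simp_all
  then have Z: "Z \<longlonglongrightarrow> x + (1 / c) *\<^sub>R y"
    unfolding Z_def by (intro tendsto_intros)
  have cone: "contingent_cone (gph \<Phi>) (J (Z k), c *\<^sub>R (Z k - J (Z k))) \<in> Zn"
    "Lk k = adj (contingent_cone (gph \<Phi>) (J (Z k), c *\<^sub>R (Z k - J (Z k))))" for k
    using Lk(1)[of k] PZ[of k] unfolding S_hat_def by (auto split: if_splits)
  have diff: "J differentiable at (Z k)" for k using contingent_cone_in_Zn(1)[OF cone(1)] .
  have Lk_eq: "Lk k = rge (transpose (B k)) (c *\<^sub>R (mat 1 - transpose (B k)))" for k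
    unfolding cone(2)[of k] contingent_cone_in_Zn(2)[OF cone(1)] B_def
    using adj_rge[OF c_pos, where M = 0] by (simp add: transpose_def zero_vec_def[symmetric])
  have "norm (B k *v h) \<le> norm h" for k h
    unfolding B_def using norm_has_derivative_le[OF jacobian_works[THEN iffD1, OF diff] nonexpansive] .
  then have "\<forall>k. B k \<in> {B. \<forall>h. norm (B *v h) \<le> norm h}" by simp
  with compact_imp_seq_compact[OF compact_nonexpansive_matrices]
  obtain B0 r where "B0 \<in> {B. \<forall>h. norm (B *v h) \<le> norm h}"
    and r: "strict_mono (r :: nat \<Rightarrow> nat)" and B0: "(B \<circ> r) \<longlonglongrightarrow> B0"
    by (rule seq_compactE)
  have B0r: "(\<lambda>k. B (r k)) \<longlonglongrightarrow> B0" using B0 by (simp add: o_def)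
  have "(\<lambda>k. Z (r k)) \<longlonglongrightarrow> x + (1 / c) *\<^sub>R y"
    using LIMSEQ_subseq_LIMSEQ[OF Z r] by (simp add: o_def)
  then have mem: "B0 \<in> bouligand_subdiff J (x + (1 / c) *\<^sub>R y)"
    unfolding bouligand_subdiff_def using B0 diff by (auto simp: B_def o_def)
  define L0 where "L0 = rge (transpose B0) (c *\<^sub>R (mat 1 - transpose B0))"
  have L0_lim: "(\<lambda>k. Zn_dist (Lk (r k)) L0) \<longlonglongrightarrow> 0"
    unfolding Lk_eq L0_def
  proof (rule rge_tendsto)
    show "w = 0" if "transpose B0 *v w = 0" "c *\<^sub>R (mat 1 - transpose B0) *v w = 0" for w
      using rge_parametrization_inj[of "transpose B0" w 0] that by simp
    show "(\<lambda>k. transpose (B (r k))) \<longlonglongrightarrow> transpose B0"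
      using B0r by (rule tendsto_transpose)
    show "(\<lambda>k. c *\<^sub>R (mat 1 - transpose (B (r k)))) \<longlonglongrightarrow> c *\<^sub>R (mat 1 - transpose B0)"
      using B0r by (intro tendsto_intros)
  qed
  have L_lim: "(\<lambda>k. Zn_dist (Lk (r k)) L) \<longlonglongrightarrow> 0"
    using LIMSEQ_subseq_LIMSEQ[OF Lk(2) r] by (simp add: o_def)
  have "L = L0"
  proof (rule Zn_dist_limit_unique[OF _ _ _ L_lim L0_lim])
    show "subspace (Lk (r k))" for k unfolding Lk_eq by (rule subspace_rge)
    show "subspace L" using L by (simp add: Zn_def)
    show "subspace L0" unfolding L0_def by (rule subspace_rge)
  qed
  then show ?thesis using mem that by (simp add: L0_def)
qed

text \<open>The graph of F + \<Phi> is the range of z \<mapsto> (J z, F (J z) + c (z - J z)). Where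
  \<open>J\<close> is differentiable, its cone is thus a known subspace, and continuity of
  \<open>J\<close> and of the Jacobian of \<open>F\<close> passes this to the limit.\<close>

lemma rge_in_S_star_plus_map:
  fixes F :: "real^'n \<Rightarrow> real^'n"
  assumes F_diff: "\<And>x. F differentiable at x"
    and F_C1: "continuous_on UNIV (\<lambda>x. jacobian F (at x))"
    and B: "B \<in> bouligand_subdiff J z"
  shows "rge (transpose B)
      (c *\<^sub>R (mat 1 - transpose B) + transpose (jacobian F (at (J z))) ** transpose B)
    \<in> S_star (plus_map F \<Phi>) (J z, F (J z) + c *\<^sub>R (z - J z))" (is "?L \<in> _")
proof -
  define \<Psi> where "\<Psi> y = (J y, F (J y) + c *\<^sub>R (y - J y))" for y
  \<comment> \<open>Left inverse of \<open>\<Psi>\<close>: subtract F, then recover the parameter as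
    x + y / c.\<close>
  define \<sigma> where "\<sigma> p = fst p + (1 / c) *\<^sub>R (snd p - F (fst p))" for p :: "(real^'n) \<times> (real^'n)"
  have gph: "gph (plus_map F \<Phi>) = range \<Psi>"
  proof -
    have "gph (plus_map F \<Phi>) = (\<lambda>p. (fst p, F (fst p) + snd p)) ` gph \<Phi>"
      by (force simp: gph_def plus_map_def)
    then show ?thesis unfolding gph_eq \<Psi>_def by (simp add: image_image)
  qed
  have \<sigma>\<Psi>: "\<sigma> (\<Psi> y) = y" for y using c_pos by (simp add: \<sigma>_def \<Psi>_def)
  obtain Z where Z: "Z \<longlonglongrightarrow> z" "\<And>k::nat. J differentiable at (Z k)"
    "(\<lambda>k. jacobian J (at (Z k))) \<longlonglongrightarrow> B"
    using B by (auto simp: bouligand_subdiff_def)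
  define Bk Mk where "Bk k = jacobian J (at (Z k))" and "Mk k = jacobian F (at (J (Z k)))" for k
  define Lk where "Lk k = rge (transpose (Bk k))
    (c *\<^sub>R (mat 1 - transpose (Bk k)) + transpose (Mk k) ** transpose (Bk k))" for k
  have "(\<lambda>k. J (Z k) - J z) \<longlonglongrightarrow> 0"
  proof (rule Lim_null_comparison)
    show "\<forall>\<^sub>F k in sequentially. norm (J (Z k) - J z) \<le> norm (Z k - z)"
      using nonexpansive by simp
    show "(\<lambda>k. norm (Z k - z)) \<longlonglongrightarrow> 0"
      using Z(1) by (intro tendsto_norm_zero) (rule LIM_zero)
  qed
  then have JZ: "(\<lambda>k. J (Z k)) \<longlonglongrightarrow> J z" by (rule LIM_zero_cancel)
  have F_deriv: "(F has_derivative (*v) (jacobian F (at x))) (at x)" for x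
    using F_diff jacobian_works by blast
  have cone: "contingent_cone (range \<Psi>) (\<Psi> (Z k)) = rge (Bk k) (c *\<^sub>R (mat 1 - Bk k) + Mk k ** Bk k)" for k
  proof -
    have J': "(J has_derivative (*v) (Bk k)) (at (Z k))"
      using Z(2) jacobian_works unfolding Bk_def by blast
    have "((\<lambda>y. F (J y)) has_derivative (\<lambda>h. Mk k *v (Bk k *v h))) (at (Z k))"
      using diff_chain_at[OF J' F_deriv] by (simp add: o_def Mk_def)
    then have \<Psi>': "(\<Psi> has_derivative
        (\<lambda>h. (Bk k *v h, Mk k *v (Bk k *v h) + c *\<^sub>R (h - Bk k *v h)))) (at (Z k))"
      unfolding \<Psi>_def using J' by (intro derivative_intros)
    have "((\<lambda>p. F (fst p)) has_derivative (\<lambda>w. Mk k *v fst w)) (at (\<Psi> (Z k)))"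
      using has_derivative_compose[OF has_derivative_fst[OF has_derivative_ident] F_deriv,
          where x = "\<Psi> (Z k)"]
      by (simp add: Mk_def \<Psi>_def)
    then have "(\<sigma> has_derivative (\<lambda>w. fst w + (1 / c) *\<^sub>R (snd w - Mk k *v fst w))) (at (\<Psi> (Z k)))"
      unfolding \<sigma>_def by (intro derivative_intros)
    from contingent_cone_range[OF \<sigma>\<Psi> \<Psi>' this] show ?thesis
      unfolding rge_def
      by (simp add: scaleR_matrix_vector_assoc[symmetric] matrix_vector_mult_diff_rdistrib
          matrix_vector_mult_add_rdistrib matrix_vector_mul_assoc[symmetric] add.commute)
  qed
  have "Lk k \<in> S_hat (plus_map F \<Phi>) (\<Psi> (Z k))" for k
  proof -
    have "rge (Bk k) (c *\<^sub>R (mat 1 - Bk k) + Mk k ** Bk k) \<in> Zn"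
      using rge_parametrization_inj by (rule rge_in_Zn)
    then show ?thesis
      unfolding S_hat_def gph cone by (simp add: adj_rge[OF c_pos] Lk_def)
  qed
  moreover have "(\<lambda>k. Zn_dist (Lk k) ?L) \<longlonglongrightarrow> 0"
    unfolding Lk_def
  proof (rule rge_tendsto)
    show "w = 0" if "transpose B *v w = 0"
      "(c *\<^sub>R (mat 1 - transpose B) + transpose (jacobian F (at (J z))) ** transpose B) *v w = 0" for w
      using rge_parametrization_inj that by blast
    have Bk: "Bk \<longlonglongrightarrow> B" using Z(3) by (simp add: Bk_def[abs_def])
    then show "(\<lambda>k. transpose (Bk k)) \<longlonglongrightarrow> transpose B" by (rule tendsto_transpose)
    have "isCont (\<lambda>x. jacobian F (at x)) (J z)"
      using F_C1 by (simp add: continuous_on_eq_continuous_at)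
    then have "Mk \<longlonglongrightarrow> jacobian F (at (J z))"
      unfolding Mk_def using JZ by (rule isCont_tendsto_compose)
    then show "(\<lambda>k. c *\<^sub>R (mat 1 - transpose (Bk k)) + transpose (Mk k) ** transpose (Bk k)) \<longlonglongrightarrow>
        c *\<^sub>R (mat 1 - transpose B) + transpose (jacobian F (at (J z))) ** transpose B"
      using Bk by (intro tendsto_intros)
  qed
  moreover have "(\<lambda>k. \<Psi> (Z k)) \<longlonglongrightarrow> \<Psi> z"
  proof -
    have "isCont F (J z)" using F_diff differentiable_imp_continuous_within by blast
    then have "(\<lambda>k. F (J (Z k))) \<longlonglongrightarrow> F (J z)" using JZ by (rule isCont_tendsto_compose)
    then show ?thesis unfolding \<Psi>_def using JZ Z(1) by (intro tendsto_intros)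
  qed
  moreover have "?L \<in> Zn" using rge_parametrization_inj by (rule rge_in_Zn)
  ultimately have "?L \<in> S_star (plus_map F \<Phi>) (\<Psi> z)"
    unfolding S_star_def gph
    by (intro CollectI conjI exI[of _ "\<lambda>k. \<Psi> (Z k)"] exI[of _ Lk]) auto
  then show ?thesis by (simp add: \<Psi>_def)
qed

end

subsection \<open>The proximal mapping\<close>

text \<open>A hyperplane separates the point \<open>(x0, r0 - 1)\<close>, just below the graph, from
  the epigraph.\<close>

lemma closed_proper_convex_affine_minorant:
  assumes q: "closed_proper_convex q"
  obtains a b where "\<And>x. ereal (a \<bullet> x + b) \<le> q x"
proof -
  let ?E = "{(x, r :: real). q x \<le> ereal r}"
  obtain x0 where x0: "q x0 \<noteq> \<infinity>" using q by (auto simp: closed_proper_convex_def)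
  have fin: "q x \<noteq> - \<infinity>" for x using q by (auto simp: closed_proper_convex_def)
  obtain r0 where r0: "q x0 = ereal r0" using x0 fin[of x0] by (cases "q x0") auto
  have "(x0, r0 - 1) \<notin> ?E" by (simp add: r0)
  then obtain n d where nd: "n \<bullet> (x0, r0 - 1) < d" "\<And>p. p \<in> ?E \<Longrightarrow> n \<bullet> p > d"
    using separating_hyperplane_closed_point[of ?E] q unfolding closed_proper_convex_def by metis
  obtain u s where n: "n = (u, s)" by (cases n)
  have sep: "u \<bullet> x + s * r > d" if "q x \<le> ereal r" for x r
    using nd(2)[of "(x, r)"] that by (simp add: n)
  \<comment> \<open>\<open>(x0, r0)\<close> lies in the epigraph and the separated point vertically
    below it, so the hyperplane is not vertical.\<close>
  have "s > 0" using sep[of x0 r0] nd(1) by (simp add: n r0 algebra_simps)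
  show ?thesis
  proof (rule that)
    fix x
    show "ereal ((- (1 / s) *\<^sub>R u) \<bullet> x + d / s) \<le> q x"
    proof (cases "q x")
      case (real r)
      then have "s * r > d - u \<bullet> x" using sep[of x r] by simp
      then have "r > (d - u \<bullet> x) / s" using \<open>s > 0\<close> by (simp add: divide_simps mult.commute)
      then show ?thesis using real by (simp add: diff_divide_distrib)
    qed (use fin in auto)
  qed
qed

text \<open>Minimizing r + \<gamma> / 2 |x - z|^2 over the pairs (x, r) of the epigraph replaces an
  extended-real function by a continuous real one. Its sublevel sets there are compact because the
  quadratic outgrows the affine minorant.\<close>

lemma prox_minimizer_exists:
  assumes q: "closed_proper_convex q" and "\<gamma> > 0"
  obtains p where "\<And>w. q p + ereal (\<gamma> / 2 * (norm (p - z))\<^sup>2) \<le> q w + ereal (\<gamma> / 2 * (norm (w - z))\<^sup>2)"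
proof -
  let ?E = "{(x, r :: real). q x \<le> ereal r}"
  obtain a b where ab: "\<And>x. ereal (a \<bullet> x + b) \<le> q x"
    using closed_proper_convex_affine_minorant[OF q] by metis
  have fin: "q x \<noteq> - \<infinity>" for x using q by (auto simp: closed_proper_convex_def)
  obtain x0 where x0: "q x0 \<noteq> \<infinity>" using q by (auto simp: closed_proper_convex_def)
  obtain r0 where r0: "q x0 = ereal r0" using x0 fin[of x0] by (cases "q x0") auto
  define f where "f p = snd p + \<gamma> / 2 * (norm (fst p - z))\<^sup>2" for p :: "'a \<times> real"
  define C where "C = ?E \<inter> {p. f p \<le> f (x0, r0)}"
  have cont: "continuous_on UNIV f"
    unfolding f_def by (intro continuous_intros)
  have "closed C"
    unfolding C_def using q closed_Collect_le[OF cont continuous_on_const]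
    by (intro closed_Int) (auto simp: closed_proper_convex_def)
  moreover have "bounded C"
  proof -
    define M where "M = f (x0, r0)"
    \<comment> \<open>Let n = |x - z| and m = |M - b - a . z|. Beyond \<open>R\<close> one has
      \<gamma> / 2 n - |a| > sqrt (\<gamma> m), hence also \<gamma> n \<ge> sqrt (\<gamma> m).
      Multiplying the first by n gives \<gamma> / 2 n^2 - |a| n > m, against the bound from the
      sublevel set.\<close>
    define R where "R = 2 * (norm a + sqrt (\<gamma> * \<bar>M - b - a \<bullet> z\<bar>)) / \<gamma>"
    have bd: "norm (x - z) \<le> R" if "(x, r) \<in> C" for x r
    proof -
      have "a \<bullet> x + b \<le> r" using ab[of x] that by (auto simp: C_def dest: order_trans)
      then have le: "a \<bullet> (x - z) + \<gamma> / 2 * (norm (x - z))\<^sup>2 \<le> \<bar>M - b - a \<bullet> z\<bar>"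
      proof -
        have "r + \<gamma> / 2 * (norm (x - z))\<^sup>2 \<le> M" using that by (simp add: C_def f_def M_def)
        then show ?thesis
          using \<open>a \<bullet> x + b \<le> r\<close> abs_ge_self[of "M - b - a \<bullet> z"]
          unfolding inner_diff_right by linarith
      qed
      define n m where "n = norm (x - z)" and "m = \<bar>M - b - a \<bullet> z\<bar>"
      have "- (norm a * n) \<le> a \<bullet> (x - z)"
        using norm_cauchy_schwarz[of "- a" "x - z"] by (simp add: n_def)
      then have quad: "\<gamma> / 2 * n\<^sup>2 - norm a * n \<le> m" using le by (simp add: n_def m_def)
      show ?thesis
      proof (rule ccontr)
        assume "\<not> ?thesis"
        then have "n * \<gamma> > 2 * (norm a + sqrt (\<gamma> * m))"
          using \<open>\<gamma> > 0\<close> by (simp add: R_def n_def m_def field_simps)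
        then have g: "\<gamma> / 2 * n - norm a > sqrt (\<gamma> * m)" by (simp add: mult.commute[of n \<gamma>])
        have "m \<ge> 0" by (simp add: m_def)
        have n: "n \<ge> 0" by (simp add: n_def)
        have "\<gamma> * n \<ge> sqrt (\<gamma> * m)"
          using g n \<open>\<gamma> > 0\<close> norm_ge_zero[of a] mult_nonneg_nonneg[of \<gamma> n] by linarith
        then have "sqrt (\<gamma> * m) * sqrt (\<gamma> * m) \<le> \<gamma> * n * sqrt (\<gamma> * m)"
          using \<open>m \<ge> 0\<close> \<open>\<gamma> > 0\<close> by (intro mult_right_mono) auto
        then have "m \<le> n * sqrt (\<gamma> * m)"
          using \<open>m \<ge> 0\<close> \<open>\<gamma> > 0\<close> by (simp add: mult.assoc)
        moreover have "n > 0"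
        proof (rule ccontr)
          assume "\<not> n > 0"
          then have "n = 0" using n by simp
          then have "sqrt (\<gamma> * m) < - norm a" using g by simp
          moreover have "0 \<le> sqrt (\<gamma> * m)" using \<open>m \<ge> 0\<close> \<open>\<gamma> > 0\<close> by simp
          ultimately show False using norm_ge_zero[of a] by linarith
        qed
        then have "n * sqrt (\<gamma> * m) < n * (\<gamma> / 2 * n - norm a)" using g by simp
        ultimately show False using quad by (simp add: power2_eq_square algebra_simps)
      qed
    qed
    have bd': "\<bar>r\<bar> \<le> \<bar>M\<bar> + norm a * (R + norm z) + \<bar>b\<bar>" if "(x, r) \<in> C" for x r
    proof -
      have "a \<bullet> x + b \<le> r" using ab[of x] that by (auto simp: C_def dest: order_trans)
      moreover have "r \<le> M"
      proof -
        have "r + \<gamma> / 2 * (norm (x - z))\<^sup>2 \<le> M" using that by (simp add: C_def f_def M_def)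
        moreover have "0 \<le> \<gamma> / 2 * (norm (x - z))\<^sup>2" using \<open>\<gamma> > 0\<close> by simp
        ultimately show ?thesis by linarith
      qed
      moreover have "- (norm a * norm x) \<le> a \<bullet> x" using norm_cauchy_schwarz[of "- a" x] by simp
      moreover have "norm a * norm x \<le> norm a * (R + norm z)"
        using bd[OF that] norm_triangle_sub[of x z] by (intro mult_left_mono) auto
      moreover have "0 \<le> norm a * norm x" by simp
      ultimately show ?thesis by linarith
    qed
    show ?thesis
    proof (rule boundedI)
      fix p assume "p \<in> C"
      then have "(fst p, snd p) \<in> C" by simp
      then have "norm (fst p - z) \<le> R" "\<bar>snd p\<bar> \<le> \<bar>M\<bar> + norm a * (R + norm z) + \<bar>b\<bar>"
        using bd bd' by blast+
      then show "norm p \<le> (R + norm z) + (\<bar>M\<bar> + norm a * (R + norm z) + \<bar>b\<bar>)"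
        using norm_Pair_le[of "fst p" "snd p"] norm_triangle_sub[of "fst p" z] by simp
    qed
  qed
  ultimately have "compact C" by (simp add: compact_eq_bounded_closed)
  moreover have "(x0, r0) \<in> C" by (simp add: C_def r0)
  ultimately obtain p where p: "p \<in> C" "\<And>w. w \<in> C \<Longrightarrow> f p \<le> f w"
    using continuous_attains_inf[of C f] cont continuous_on_subset by (metis empty_iff subset_UNIV)
  \<comment> \<open>Outside \<open>C\<close> the value already exceeds that at
    \<open>(x0, r0)\<close>, so the minimum over \<open>C\<close> is global on the epigraph.\<close>
  have min: "f p \<le> f w" if "w \<in> ?E" for w
  proof (cases "w \<in> C")
    case False
    then have "f (x0, r0) \<le> f w" using that by (simp add: C_def)
    then show ?thesis using p(2)[OF \<open>(x0, r0) \<in> C\<close>] by simp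
  qed (rule p(2))
  show ?thesis
  proof (rule that[of "fst p"])
    fix w
    show "q (fst p) + ereal (\<gamma> / 2 * (norm (fst p - z))\<^sup>2) \<le> q w + ereal (\<gamma> / 2 * (norm (w - z))\<^sup>2)"
    proof (cases "q w")
      case (real r)
      have "q (fst p) \<le> ereal (snd p)" using p(1) by (auto simp: C_def)
      then have "q (fst p) + ereal (\<gamma> / 2 * (norm (fst p - z))\<^sup>2) \<le> ereal (f p)"
        unfolding f_def plus_ereal.simps(1)[symmetric] by (rule add_right_mono)
      also have "\<dots> \<le> ereal (f (w, r))" using min[of "(w, r)"] real by simp
      finally show ?thesis by (simp add: real f_def)
    qed (use fin in auto)
  qed
qed

lemma prox_le:
  assumes "closed_proper_convex q" "\<gamma> > 0"
  shows "q (prox \<gamma> q z) + ereal (\<gamma> / 2 * (norm (prox \<gamma> q z - z))\<^sup>2)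
    \<le> q w + ereal (\<gamma> / 2 * (norm (w - z))\<^sup>2)"
proof -
  obtain p where "\<And>w. q p + ereal (\<gamma> / 2 * (norm (p - z))\<^sup>2) \<le> q w + ereal (\<gamma> / 2 * (norm (w - z))\<^sup>2)"
    using prox_minimizer_exists[OF assms] by metis
  then have "is_arg_min (\<lambda>w. q w + ereal (\<gamma> / 2 * (norm (w - z))\<^sup>2)) (\<lambda>w. True) p"
    by (auto simp: is_arg_min_def not_less)
  then have "is_arg_min (\<lambda>w. q w + ereal (\<gamma> / 2 * (norm (w - z))\<^sup>2)) (\<lambda>w. True) (prox \<gamma> q z)"
    unfolding prox_def arg_min_def by (rule someI)
  then show ?thesis by (auto simp: is_arg_min_def not_less)
qed

lemma convex_ereal_segment:
  assumes "closed_proper_convex q" "q x = ereal r" "q y = ereal s" "0 \<le> t" "t \<le> 1"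
  shows "q ((1 - t) *\<^sub>R x + t *\<^sub>R y) \<le> ereal ((1 - t) * r + t * s)"
proof -
  have "convex {(x, r :: real). q x \<le> ereal r}"
    using assms(1) by (simp add: closed_proper_convex_def)
  then have "(1 - t) *\<^sub>R (x, r) + t *\<^sub>R (y, s) \<in> {(x, r). q x \<le> ereal r}"
    by (rule convexD_alt) (use assms in auto)
  then show ?thesis by simp
qed

text \<open>The minimizer p is compared with the points p + t (y - p): convexity bounds q there,
  dividing by t leaves a defect t * \<gamma> / 2 |y - p|^2, and t tends to 0 from the right.\<close>

lemma prox_subdiff:
  assumes q: "closed_proper_convex q" and "\<gamma> > 0"
  shows "\<gamma> *\<^sub>R (z - prox \<gamma> q z) \<in> subdiff q (prox \<gamma> q z)"
proof -
  define p where "p = prox \<gamma> q z"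
  have fin: "q x \<noteq> - \<infinity>" for x using q by (auto simp: closed_proper_convex_def)
  have min: "q p + ereal (\<gamma> / 2 * (norm (p - z))\<^sup>2) \<le> q w + ereal (\<gamma> / 2 * (norm (w - z))\<^sup>2)" for w
    unfolding p_def by (rule prox_le[OF assms])
  obtain x0 where x0: "q x0 \<noteq> \<infinity>" using q by (auto simp: closed_proper_convex_def)
  have "q p \<noteq> \<infinity>" using min[of x0] x0 by (cases "q x0") auto
  then obtain r where r: "q p = ereal r" using fin[of p] by (cases "q p") auto
  have "q p + ereal ((\<gamma> *\<^sub>R (z - p)) \<bullet> (y - p)) \<le> q y" for y
  proof (cases "q y")
    case (real s)
    define i where "i = (z - p) \<bullet> (y - p)"
    have le: "r + \<gamma> * i \<le> s + t * (\<gamma> / 2 * (norm (y - p))\<^sup>2)" if t: "0 < t" "t \<le> 1" for t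
    proof -
      define w where "w = (1 - t) *\<^sub>R p + t *\<^sub>R y"
      have "q w \<le> ereal ((1 - t) * r + t * s)"
        unfolding w_def using q r real t by (intro convex_ereal_segment) auto
      then have "q w + ereal (\<gamma> / 2 * (norm (w - z))\<^sup>2)
          \<le> ereal ((1 - t) * r + t * s + \<gamma> / 2 * (norm (w - z))\<^sup>2)"
        unfolding plus_ereal.simps(1)[symmetric] by (rule add_right_mono)
      with min[of w] have "q p + ereal (\<gamma> / 2 * (norm (p - z))\<^sup>2)
          \<le> ereal ((1 - t) * r + t * s + \<gamma> / 2 * (norm (w - z))\<^sup>2)"
        by (rule order_trans)
      then have *: "r + \<gamma> / 2 * (norm (p - z))\<^sup>2 \<le> (1 - t) * r + t * s + \<gamma> / 2 * (norm (w - z))\<^sup>2"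
        by (simp add: r)
      have "w - z = (p - z) + t *\<^sub>R (y - p)" by (simp add: w_def algebra_simps)
      then have "(norm (w - z))\<^sup>2 = (norm (p - z))\<^sup>2 + 2 * t * ((p - z) \<bullet> (y - p)) + t\<^sup>2 * (norm (y - p))\<^sup>2"
        unfolding power2_norm_eq_inner
        by (simp only: inner_add_left inner_add_right inner_scaleR_left inner_scaleR_right
            inner_commute[of "y - p" "p - z"] power2_eq_square) (simp add: algebra_simps)
      also have "(p - z) \<bullet> (y - p) = - i" by (simp add: i_def inner_diff_left)
      finally have nw: "(norm (w - z))\<^sup>2 = (norm (p - z))\<^sup>2 - 2 * t * i + t\<^sup>2 * (norm (y - p))\<^sup>2" by simp
      from *[unfolded nw] have "t * (r + \<gamma> * i) \<le> t * (s + t * (\<gamma> / 2 * (norm (y - p))\<^sup>2))"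
        by (simp add: algebra_simps power2_eq_square)
      then show ?thesis using t by simp
    qed
    have "((\<lambda>t. s + t * (\<gamma> / 2 * (norm (y - p))\<^sup>2)) \<longlongrightarrow> s + 0 * (\<gamma> / 2 * (norm (y - p))\<^sup>2)) (at_right 0)"
      by (intro tendsto_intros)
    moreover have "\<forall>\<^sub>F t in at_right 0. r + \<gamma> * i \<le> s + t * (\<gamma> / 2 * (norm (y - p))\<^sup>2)"
      unfolding eventually_at_right_field using le by (intro exI[of _ 1]) auto
    ultimately have "r + \<gamma> * i \<le> s + 0 * (\<gamma> / 2 * (norm (y - p))\<^sup>2)"
      by (rule tendsto_lowerbound) simp
    then show ?thesis by (simp add: r real i_def)
  qed (use fin in auto)
  then show ?thesis
    using \<open>q p \<noteq> \<infinity>\<close> by (simp add: subdiff_def p_def[symmetric])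
qed

section \<open>Monotonicity of the subdifferential and its resolvent\<close>

lemma subdiff_monotone:
  assumes q: "closed_proper_convex q" and v: "v \<in> subdiff q x" and w: "w \<in> subdiff q y"
  shows "(v - w) \<bullet> (x - y) \<ge> 0"
proof -
  have fin: "q x \<noteq> - \<infinity>" for x using q by (auto simp: closed_proper_convex_def)
  obtain r where r: "q x = ereal r" using v fin[of x] by (cases "q x") (auto simp: subdiff_def)
  obtain s where s: "q y = ereal s" using w fin[of y] by (cases "q y") (auto simp: subdiff_def)
  have "q x + ereal (v \<bullet> (y - x)) \<le> q y" "q y + ereal (w \<bullet> (x - y)) \<le> q x"
    using v w by (auto simp: subdiff_def)
  then have "r + v \<bullet> (y - x) \<le> s" "s + w \<bullet> (x - y) \<le> r" by (simp_all add: r s)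
  then show ?thesis by (simp add: inner_diff_left inner_diff_right)
qed

text \<open>Monotonicity makes the resolvent firmly nonexpansive: |p1 - p2|^2 \<le> (z1 - z2) . (p1
  - p2). Stating it through the optimality relation instead of \<open>prox\<close> also gives
  uniqueness of the proximal point, by z1 = z2.\<close>

lemma norm_diff_le_of_subdiff:
  assumes q: "closed_proper_convex q" and "\<gamma> > 0"
    and 1: "\<gamma> *\<^sub>R (z1 - p1) \<in> subdiff q p1" and 2: "\<gamma> *\<^sub>R (z2 - p2) \<in> subdiff q p2"
  shows "norm (p1 - p2) \<le> norm (z1 - z2)"
proof -
  have "0 \<le> (\<gamma> *\<^sub>R (z1 - p1) - \<gamma> *\<^sub>R (z2 - p2)) \<bullet> (p1 - p2)"
    using subdiff_monotone[OF q 1 2] .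
  also have "\<dots> = \<gamma> * ((z1 - z2) \<bullet> (p1 - p2) - (norm (p1 - p2))\<^sup>2)"
    by (simp add: power2_norm_eq_inner algebra_simps)
  finally have "(norm (p1 - p2))\<^sup>2 \<le> (z1 - z2) \<bullet> (p1 - p2)"
    using \<open>\<gamma> > 0\<close> by (simp add: zero_le_mult_iff)
  also have "\<dots> \<le> norm (z1 - z2) * norm (p1 - p2)" by (rule norm_cauchy_schwarz)
  finally have "norm (p1 - p2) * norm (p1 - p2) \<le> norm (z1 - z2) * norm (p1 - p2)"
    by (simp add: power2_eq_square)
  then show ?thesis by (cases "p1 = p2") auto
qed

lemma prox_eqI:
  assumes "closed_proper_convex q" "\<gamma> > 0" "\<gamma> *\<^sub>R (z - p) \<in> subdiff q p"
  shows "prox \<gamma> q z = p"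
  using norm_diff_le_of_subdiff[OF assms(1,2) prox_subdiff[OF assms(1,2)] assms(3), of z] by simp

lemma gph_subdiff:
  assumes "closed_proper_convex q" "\<gamma> > 0"
  shows "gph (subdiff q) = range (\<lambda>z. (prox \<gamma> q z, \<gamma> *\<^sub>R (z - prox \<gamma> q z)))"
proof (intro set_eqI iffI)
  fix p assume "p \<in> gph (subdiff q)"
  then obtain x y where p: "p = (x, y)" "y \<in> subdiff q x" by (auto simp: gph_def)
  have "\<gamma> *\<^sub>R ((x + (1 / \<gamma>) *\<^sub>R y) - x) = y" using assms(2) by simp
  moreover from this have "prox \<gamma> q (x + (1 / \<gamma>) *\<^sub>R y) = x" using assms p(2) by (intro prox_eqI) auto
  ultimately show "p \<in> range (\<lambda>z. (prox \<gamma> q z, \<gamma> *\<^sub>R (z - prox \<gamma> q z)))"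
    unfolding p by (intro range_eqI[of _ _ "x + (1 / \<gamma>) *\<^sub>R y"]) simp
next
  fix p assume "p \<in> range (\<lambda>z. (prox \<gamma> q z, \<gamma> *\<^sub>R (z - prox \<gamma> q z)))"
  then show "p \<in> gph (subdiff q)" using prox_subdiff[OF assms] by (auto simp: gph_def)
qed

lemma nonexpansive_resolvent_prox:
  assumes "closed_proper_convex q" "c > 0"
  shows "nonexpansive_resolvent (subdiff q) (prox c q) c"
proof
  show "gph (subdiff q) = range (\<lambda>z. (prox c q z, c *\<^sub>R (z - prox c q z)))"
    using assms by (rule gph_subdiff)
  show "norm (prox c q a - prox c q b) \<le> norm (a - b)" for a b
    using norm_diff_le_of_subdiff[OF assms prox_subdiff[OF assms] prox_subdiff[OF assms]] .
qed (rule assms(2))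

subsection \<open>The Newton system\<close>

text \<open>Two matrix pairs with the same range differ by an invertible factor, which cancels from the
  linear system of Algorithm A.\<close>

lemma rge_eq_factorization:
  fixes Y X B :: "real^'n^'n"
  assumes "c > 0" and rge: "rge Y X = rge (transpose B) (c *\<^sub>R (mat 1 - transpose B))"
  obtains N where "\<And>v. N *v v = 0 \<Longrightarrow> v = 0" "transpose Y = N ** B"
    "transpose X = N ** (c *\<^sub>R (mat 1 - B))"
proof -
  \<comment> \<open>The map (x, y) \<mapsto> x + y / c sends (B^T h, c (I - B^T) h) to h, so
    \<open>M\<close> reads off the parameter of each element of the common range.\<close>
  define M where "M = Y + (1 / c) *\<^sub>R X"
  have M: "M *v w = h" if "Y *v w = transpose B *v h" "X *v w = c *\<^sub>R (mat 1 - transpose B) *v h" for w h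
    using that \<open>c > 0\<close>
    by (simp add: M_def matrix_vector_mult_add_rdistrib matrix_vector_mult_diff_rdistrib
        scaleR_matrix_vector_assoc[symmetric] del: transpose_matrix_vector)
  have YX: "Y *v w = transpose B *v (M *v w) \<and> X *v w = c *\<^sub>R (mat 1 - transpose B) *v (M *v w)" for w
  proof -
    have "(Y *v w, X *v w) \<in> rge (transpose B) (c *\<^sub>R (mat 1 - transpose B))"
      unfolding rge[symmetric] by (auto simp: rge_def)
    then obtain h where "Y *v w = transpose B *v h" "X *v w = c *\<^sub>R (mat 1 - transpose B) *v h"
      by (auto simp: rge_def simp del: transpose_matrix_vector)
    with M[OF this] show ?thesis by simp
  qed
  have surj: "\<exists>w. M *v w = h" for h
  proof -
    have "(transpose B *v h, c *\<^sub>R (mat 1 - transpose B) *v h) \<in> rge Y X"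
      unfolding rge by (auto simp: rge_def simp del: transpose_matrix_vector)
    then obtain w where "Y *v w = transpose B *v h" "X *v w = c *\<^sub>R (mat 1 - transpose B) *v h"
      by (auto simp: rge_def simp del: transpose_matrix_vector)
    from M[OF this] show ?thesis by blast
  qed
  show ?thesis
  proof (rule that[of "transpose M"])
    \<comment> \<open>\<open>M\<close> is onto, so its transpose is injective.\<close>
    fix v assume v: "transpose M *v v = 0"
    obtain w where "M *v w = v" using surj by blast
    then have "v \<bullet> v = (transpose M *v v) \<bullet> w" by (simp only: inner_transpose_mult)
    then show "v = 0" unfolding v by simp
  next
    have "Y = transpose B ** M"
      using YX by (simp add: matrix_eq matrix_vector_mul_assoc del: transpose_matrix_vector)
    then show "transpose Y = transpose M ** B" by (simp add: matrix_transpose_mul)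
    have "X = (c *\<^sub>R (mat 1 - transpose B)) ** M"
      using YX by (simp add: matrix_eq matrix_vector_mul_assoc del: transpose_matrix_vector)
    then show "transpose X = transpose M ** (c *\<^sub>R (mat 1 - B))"
      by (simp add: matrix_transpose_mul transpose_scalar transpose_diff)
  qed
qed

text \<open>\<open>c\<close> is kept apart from the step parameter: for c = \<gamma> the right-hand
  matrix is \<gamma> I, while for c = 1 the left-hand matrix does not contain \<gamma>
  explicitly.\<close>

lemma algA_eq_iff:
  assumes "c > 0" and "rge Y X = rge (transpose B) (c *\<^sub>R (mat 1 - transpose B))"
  shows "algA_eq F q \<gamma> x X Y dx \<longleftrightarrow>
    (B ** jacobian F (at x) + c *\<^sub>R (mat 1 - B)) *v dx
      = (\<gamma> *\<^sub>R B + c *\<^sub>R (mat 1 - B)) *v prox_step \<gamma> F q x"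
proof -
  obtain N where N: "\<And>v. N *v v = 0 \<Longrightarrow> v = 0" "transpose Y = N ** B"
    "transpose X = N ** (c *\<^sub>R (mat 1 - B))"
    using rge_eq_factorization[OF assms] by metis
  have "transpose Y ** jacobian F (at x) + transpose X
      = N ** (B ** jacobian F (at x) + c *\<^sub>R (mat 1 - B))"
    unfolding N by (simp add: matrix_add_ldistrib matrix_mul_assoc)
  moreover have "\<gamma> *\<^sub>R transpose Y + transpose X = N ** (\<gamma> *\<^sub>R B + c *\<^sub>R (mat 1 - B))"
    unfolding N by (simp add: matrix_add_ldistrib matrix_scalar_ac scalar_matrix_assoc)
  moreover have "N *v v = N *v v' \<longleftrightarrow> v = v'" for v v'
    using N(1)[of "v - v'"] by (auto simp: matrix_vector_mult_diff_distrib)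
  ultimately show ?thesis
    unfolding algA_eq_def by (simp add: matrix_vector_mul_assoc[symmetric])
qed

text \<open>The base point is d + ds / c. For c = \<gamma> it reduces to x - F x / \<gamma>, the
  point at which \<open>T_u\<close> takes the Bouligand subdifferential.\<close>

lemma algA_select_bouligand:
  assumes q: "closed_proper_convex q" and "c > 0" and "algA_select F q \<gamma> x X Y"
  obtains B where "B \<in> bouligand_subdiff (prox c q) (x + prox_step \<gamma> F q x
      - (1 / c) *\<^sub>R (\<gamma> *\<^sub>R prox_step \<gamma> F q x + F x))"
    "rge Y X = rge (transpose B) (c *\<^sub>R (mat 1 - transpose B))"
proof -
  interpret nonexpansive_resolvent "subdiff q" "prox c q" c
    using q \<open>c > 0\<close> by (rule nonexpansive_resolvent_prox)
  have "rge Y X \<in> S_star (subdiff q) (x + prox_step \<gamma> F q x, - (\<gamma> *\<^sub>R prox_step \<gamma> F q x) - F x)"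
    using assms(3) by (simp add: algA_select_def Let_def)
  then obtain B where B: "B \<in> bouligand_subdiff (prox c q) (x + prox_step \<gamma> F q x
      + (1 / c) *\<^sub>R (- (\<gamma> *\<^sub>R prox_step \<gamma> F q x) - F x))"
    "rge Y X = rge (transpose B) (c *\<^sub>R (mat 1 - transpose B))"
    by (rule S_star_subset)
  have "x + prox_step \<gamma> F q x + (1 / c) *\<^sub>R (- (\<gamma> *\<^sub>R prox_step \<gamma> F q x) - F x)
      = x + prox_step \<gamma> F q x - (1 / c) *\<^sub>R (\<gamma> *\<^sub>R prox_step \<gamma> F q x + F x)"
    by (simp add: algebra_simps)
  with B that show ?thesis by metis
qed

text \<open>With c = \<gamma> the right-hand side becomes \<gamma> u, and dividing the system by -
  \<gamma> gives that of Algorithm B.\<close>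

lemma algA_step_is_algB_step:
  assumes q: "closed_proper_convex q" and "\<gamma> > 0"
    and sel: "algA_select F q \<gamma> x X Y" and eq: "algA_eq F q \<gamma> x X Y dx"
  shows "\<exists>V\<in>T_u \<gamma> F q x. V *v dx = - prox_step \<gamma> F q x"
proof -
  let ?u = "prox_step \<gamma> F q x" and ?F' = "jacobian F (at x)"
  obtain B where B: "B \<in> bouligand_subdiff (prox \<gamma> q) (x + ?u - (1 / \<gamma>) *\<^sub>R (\<gamma> *\<^sub>R ?u + F x))"
    "rge Y X = rge (transpose B) (\<gamma> *\<^sub>R (mat 1 - transpose B))"
    using algA_select_bouligand[OF q \<open>\<gamma> > 0\<close> sel] by metis
  have "x + ?u - (1 / \<gamma>) *\<^sub>R (\<gamma> *\<^sub>R ?u + F x) = x - (1 / \<gamma>) *\<^sub>R F x"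
    using \<open>\<gamma> > 0\<close> by (simp add: scaleR_add_right)
  with B have "B ** (mat 1 - (1 / \<gamma>) *\<^sub>R ?F') - mat 1 \<in> T_u \<gamma> F q x"
    unfolding T_u_def by auto
  moreover have "(B ** (mat 1 - (1 / \<gamma>) *\<^sub>R ?F') - mat 1) *v dx = - ?u"
  proof -
    have "B *v (?F' *v dx) + \<gamma> *\<^sub>R (dx - B *v dx) = \<gamma> *\<^sub>R (B *v ?u) + \<gamma> *\<^sub>R (?u - B *v ?u)"
      using eq[unfolded algA_eq_iff[OF \<open>\<gamma> > 0\<close> B(2)]]
      by (simp only: matrix_vector_mult_add_rdistrib matrix_vector_mult_diff_rdistrib
          scaleR_matrix_vector_assoc[symmetric] matrix_vector_mul_assoc[symmetric]
          matrix_vector_mul_lid)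
    also have "\<dots> = \<gamma> *\<^sub>R ?u" by (simp add: algebra_simps)
    finally have "(1 / \<gamma>) *\<^sub>R (B *v (?F' *v dx) + \<gamma> *\<^sub>R (dx - B *v dx)) = ?u"
      using \<open>\<gamma> > 0\<close> by simp
    then have "(1 / \<gamma>) *\<^sub>R (B *v (?F' *v dx)) + (dx - B *v dx) = ?u"
      using \<open>\<gamma> > 0\<close> by (simp only: scaleR_add_right scaleR_scaleR) simp
    moreover have "(B ** (mat 1 - (1 / \<gamma>) *\<^sub>R ?F') - mat 1) *v dx
        = B *v dx - (1 / \<gamma>) *\<^sub>R (B *v (?F' *v dx)) - dx"
      by (simp only: matrix_vector_mult_diff_rdistrib matrix_vector_mult_diff_distrib
          scaleR_matrix_vector_assoc[symmetric] matrix_vector_mul_assoc[symmetric]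
          matrix_vector_mul_lid matrix_vector_mult_scaleR)
    ultimately show ?thesis by (simp add: algebra_simps)
  qed
  ultimately show ?thesis by blast
qed

subsection \<open>Local convergence\<close>

lemma solves_iff: "solves F q x \<longleftrightarrow> - F x \<in> subdiff q x"
  by (auto simp: solves_def plus_map_def add_eq_0_iff)

lemma prox_step_in_gph:
  assumes "closed_proper_convex q" "\<gamma> > 0"
  shows "(x + prox_step \<gamma> F q x, - (\<gamma> *\<^sub>R prox_step \<gamma> F q x) - F x) \<in> gph (subdiff q)"
proof -
  have "\<gamma> *\<^sub>R ((x - (1 / \<gamma>) *\<^sub>R F x) - (x + prox_step \<gamma> F q x))
      = - (\<gamma> *\<^sub>R prox_step \<gamma> F q x) - F x"
    using assms(2) by (simp add: algebra_simps)
  moreover have "x + prox_step \<gamma> F q x = prox \<gamma> q (x - (1 / \<gamma>) *\<^sub>R F x)"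
    by (simp add: prox_step_def)
  ultimately show ?thesis
    using prox_subdiff[OF assms, of "x - (1 / \<gamma>) *\<^sub>R F x"] by (simp add: gph_def)
qed

lemma prox_step_eq_0:
  assumes "closed_proper_convex q" "\<gamma> > 0" "solves F q x"
  shows "prox_step \<gamma> F q x = 0"
proof -
  have "prox \<gamma> q (x - (1 / \<gamma>) *\<^sub>R F x) = x"
    using assms by (intro prox_eqI) (simp_all add: solves_iff)
  then show ?thesis by (simp add: prox_step_def)
qed

locale scd_newton =
  fixes F :: "real^'n \<Rightarrow> real^'n" and q :: "real^'n \<Rightarrow> ereal" and xbar :: "real^'n"
  assumes F_diff: "\<And>x. F differentiable at x"
    and F_C1: "continuous_on UNIV (\<lambda>x. jacobian F (at x))"
    and q: "closed_proper_convex q"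
    and sol: "solves F q xbar"
    and semismooth: "SCD_semismooth_at (subdiff q) (xbar, - F xbar)"
    and regular: "SCD_regular_around (plus_map F (subdiff q)) (xbar, 0)"
begin

section \<open>Newton matrices and their uniform invertibility\<close>

sublocale nonexpansive_resolvent "subdiff q" "prox 1 q" 1
  using q by (rule nonexpansive_resolvent_prox) simp

text \<open>The factor \<open>1 *\<^sub>R\<close> keeps the term literally equal to the instance c =
  1 of the general lemmas.\<close>

abbreviation newton_matrix :: "real^'n^'n \<Rightarrow> real^'n \<Rightarrow> real^'n^'n" where
  "newton_matrix B x \<equiv> B ** jacobian F (at x) + 1 *\<^sub>R (mat 1 - B)"

lemma newton_matrix_mult:
  "newton_matrix B x *v w = B *v (jacobian F (at x) *v w) + (w - B *v w)"
  by (simp add: matrix_vector_mult_add_rdistrib matrix_vector_mult_diff_rdistrib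
      matrix_vector_mul_assoc[symmetric])

lemma jacobian_tendsto:
  assumes "X \<longlonglongrightarrow> x"
  shows "(\<lambda>k. jacobian F (at (X k))) \<longlonglongrightarrow> jacobian F (at x)"
proof -
  have "isCont (\<lambda>x. jacobian F (at x)) x"
    using F_C1 by (simp add: continuous_on_eq_continuous_at)
  then show ?thesis using assms by (rule isCont_tendsto_compose)
qed

text \<open>SCD regularity says that the transposed Newton matrices at the solution are injective.\<close>

lemma newton_matrix_inj:
  assumes B: "B \<in> bouligand_subdiff (prox 1 q) (xbar - F xbar)"
    and v: "newton_matrix B xbar *v v = 0"
  shows "v = 0"
proof -
  let ?F' = "jacobian F (at xbar)"
  let ?G = "1 *\<^sub>R (mat 1 - transpose B) + transpose ?F' ** transpose B"
  have prox: "prox 1 q (xbar - F xbar) = xbar"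
    using q sol by (intro prox_eqI) (simp_all add: solves_iff)
  have S: "rge (transpose B) ?G \<in> S_star (plus_map F (subdiff q)) (xbar, 0)"
  proof -
    have "F xbar + 1 *\<^sub>R (xbar - F xbar - xbar) = 0" by simp
    then show ?thesis using rge_in_S_star_plus_map[OF F_diff F_C1 B] by (simp only: prox)
  qed
  have inj: "h = 0" if h: "?G *v h = 0" for h
  proof -
    \<comment> \<open>Regularity applied to this element only gives B^T h = 0; that h vanishes
      follows from injectivity of the parametrization.\<close>
    have "(transpose B *v h, 0) \<in> rge (transpose B) ?G"
      unfolding rge_def by (rule range_eqI[of _ _ h]) (simp only: h)
    then have "transpose B *v h = 0"
      using regular S unfolding SCD_regular_around_def by blast
    then show ?thesis using h by (rule rge_parametrization_inj)
  qed
  have "linear ((*v) ?G)" by (rule matrix_vector_mul_linear)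
  moreover have "inj ((*v) ?G)"
    using inj unfolding linear_injective_0[OF \<open>linear ((*v) ?G)\<close>] by blast
  ultimately have "surj ((*v) ?G)" by (rule linear_injective_imp_surjective) simp
  then obtain h where h: "?G *v h = v" by (metis surjD)
  have "?G = transpose (newton_matrix B xbar)"
    by (simp add: transpose_add transpose_diff matrix_transpose_mul)
  then have "v \<bullet> v = h \<bullet> (newton_matrix B xbar *v v)"
    using h inner_transpose_mult by metis
  then show ?thesis unfolding v by simp
qed

text \<open>A violating sequence would have B in the compact set of nonexpansive matrices and, after
  scaling, unit vectors. Closedness of the Bouligand subdifferential places the limit matrix at the
  solution, where the Newton matrix is injective.\<close>

lemma newton_matrix_bounded_below:
  obtains r c where "r > 0" "c > 0"
    "\<And>x z B w. norm (x - xbar) < r \<Longrightarrow> norm (z - (xbar - F xbar)) < r \<Longrightarrow>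
      B \<in> bouligand_subdiff (prox 1 q) z \<Longrightarrow> c * norm w \<le> norm (newton_matrix B x *v w)"
proof (rule ccontr)
  assume "\<not> thesis"
  define e where "e k = inverse (real (Suc k))" for k
  have e_pos: "e k > 0" and e0: "e \<longlonglongrightarrow> 0" for k
    unfolding e_def using LIMSEQ_inverse_real_of_nat by auto
  \<comment> \<open>\<open>e k\<close> serves both as the radius and as the lower bound to be
    violated.\<close>
  have "\<exists>x z B w. norm (x - xbar) < e k \<and> norm (z - (xbar - F xbar)) < e k \<and>
      B \<in> bouligand_subdiff (prox 1 q) z \<and> norm (newton_matrix B x *v w) < e k * norm w" for k
    using that[OF e_pos[of k] e_pos[of k]] \<open>\<not> thesis\<close> not_le by blast
  then obtain x z B w where x: "\<And>k. norm (x k - xbar) < e k"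
    and z: "\<And>k. norm (z k - (xbar - F xbar)) < e k"
    and B: "\<And>k. B k \<in> bouligand_subdiff (prox 1 q) (z k)"
    and w: "\<And>k. norm (newton_matrix (B k) (x k) *v w k) < e k * norm (w k)"
    by metis
  define v where "v k = (1 / norm (w k)) *\<^sub>R w k" for k
  have w_pos: "norm (w k) > 0" for k using w[of k] by (cases "w k = 0") auto
  have v: "norm (newton_matrix (B k) (x k) *v v k) \<le> e k" for k
  proof -
    have "norm (newton_matrix (B k) (x k) *v v k) = norm (newton_matrix (B k) (x k) *v w k) / norm (w k)"
      unfolding v_def matrix_vector_mult_scaleR by simp
    also have "\<dots> \<le> e k" using less_imp_le[OF w] w_pos by (simp only: pos_divide_le_eq)
    finally show ?thesis .
  qed
  have "seq_compact ({B :: real^'n^'n. \<forall>h. norm (B *v h) \<le> norm h} \<times> sphere (0 :: real^'n) 1)"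
    by (intro compact_imp_seq_compact compact_Times compact_nonexpansive_matrices compact_sphere)
  moreover have "\<forall>k. (B k, v k) \<in> {B. \<forall>h. norm (B *v h) \<le> norm h} \<times> sphere 0 1"
    using bouligand_subdiff_nonexpansive[OF nonexpansive B] w_pos by (simp add: v_def)
  ultimately obtain l r where l: "l \<in> {B :: real^'n^'n. \<forall>h. norm (B *v h) \<le> norm h} \<times> sphere (0 :: real^'n) 1"
    and r: "strict_mono (r :: nat \<Rightarrow> nat)" and lim: "((\<lambda>k. (B k, v k)) \<circ> r) \<longlonglongrightarrow> l"
    by (rule seq_compactE)
  define B0 v0 where "B0 = fst l" and "v0 = snd l"
  have Br: "(\<lambda>k. B (r k)) \<longlonglongrightarrow> B0" and vr: "(\<lambda>k. v (r k)) \<longlonglongrightarrow> v0"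
    using tendsto_fst[OF lim] tendsto_snd[OF lim] by (simp_all add: B0_def v0_def)
  have er: "(\<lambda>k. e (r k)) \<longlonglongrightarrow> 0" using LIMSEQ_subseq_LIMSEQ[OF e0 r] by (simp add: o_def)
  have null: "Y \<longlonglongrightarrow> y" if "\<And>k. norm (Y k - y) \<le> e (r k)" for Y and y :: "real^'n"
  proof (rule LIM_zero_cancel, rule Lim_null_comparison[OF _ er])
    show "\<forall>\<^sub>F k in sequentially. norm (Y k - y) \<le> e (r k)" using that by simp
  qed
  have xr: "(\<lambda>k. x (r k)) \<longlonglongrightarrow> xbar" using x by (intro null) (simp add: less_imp_le)
  have zr: "(\<lambda>k. z (r k)) \<longlonglongrightarrow> xbar - F xbar" using z by (intro null) (simp add: less_imp_le)
  have "B0 \<in> bouligand_subdiff (prox 1 q) (xbar - F xbar)"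
    using bouligand_subdiff_closed[OF B zr Br] .
  moreover have "newton_matrix B0 xbar *v v0 = 0"
  proof (rule LIMSEQ_unique)
    show "(\<lambda>k. newton_matrix (B (r k)) (x (r k)) *v v (r k)) \<longlonglongrightarrow> newton_matrix B0 xbar *v v0"
      using Br vr jacobian_tendsto[OF xr] by (intro tendsto_intros)
    show "(\<lambda>k. newton_matrix (B (r k)) (x (r k)) *v v (r k)) \<longlonglongrightarrow> 0"
      using v by (intro null) (simp only: diff_zero)
  qed
  ultimately have "v0 = 0" by (rule newton_matrix_inj)
  then show False using l by (auto simp: v0_def)
qed

text \<open>The test element of the subspace is the parametrization at the residual g itself, (B^T
  g, g - B^T g). Once the transposes are moved across, the pairing in the semismoothness inequality
  is g . g, so one factor norm g cancels.\<close>

lemma semismooth_resolvent_estimate: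
  assumes "\<epsilon> > 0"
  obtains \<delta> where "\<delta> > 0"
    "\<And>d ds B. (d, ds) \<in> gph (subdiff q) \<Longrightarrow> norm ((d, ds) - (xbar, - F xbar)) \<le> \<delta> \<Longrightarrow>
      rge (transpose B) (1 *\<^sub>R (mat 1 - transpose B)) \<in> S_star (subdiff q) (d, ds) \<Longrightarrow>
      (\<And>h. norm (B *v h) \<le> norm h) \<Longrightarrow>
      norm ((d - xbar) - B *v (d - xbar) - B *v (ds + F xbar))
        \<le> \<epsilon> * norm ((d, ds) - (xbar, - F xbar))"
proof -
  \<comment> \<open>The 3 absorbs norm (g - ys, ys) \<le> norm g + 2 norm ys \<le> 3 norm g.\<close>
  obtain \<delta> where "\<delta> > 0" and \<delta>: "\<And>x y xs ys. (x, y) \<in> gph (subdiff q) \<Longrightarrow>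
      dist (x, y) (xbar, - F xbar) \<le> \<delta> \<Longrightarrow> (ys, xs) \<in> \<Union> (S_star (subdiff q) (x, y)) \<Longrightarrow>
      \<bar>xs \<bullet> (x - xbar) - ys \<bullet> (y + F xbar)\<bar> \<le> \<epsilon> / 3 * norm ((x, y) - (xbar, - F xbar)) * norm (xs, ys)"
    using semismooth \<open>\<epsilon> > 0\<close> unfolding SCD_semismooth_at_def
    by (metis (no_types, lifting) divide_pos_pos zero_less_numeral fst_conv snd_conv diff_minus_eq_add)
  show ?thesis
  proof (rule that[OF \<open>\<delta> > 0\<close>])
    fix d ds and B :: "real^'n^'n"
    assume gph: "(d, ds) \<in> gph (subdiff q)" and dist: "norm ((d, ds) - (xbar, - F xbar)) \<le> \<delta>"
      and S: "rge (transpose B) (1 *\<^sub>R (mat 1 - transpose B)) \<in> S_star (subdiff q) (d, ds)"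
      and B: "\<And>h. norm (B *v h) \<le> norm h"
    define n where "n = norm ((d, ds) - (xbar, - F xbar))"
    define g where "g = (d - xbar) - B *v (d - xbar) - B *v (ds + F xbar)"
    define ys where "ys = transpose B *v g"
    \<comment> \<open>The transpose of a nonexpansive matrix is nonexpansive.\<close>
    have "norm ys * norm ys = ys \<bullet> ys" by (simp add: dot_square_norm power2_eq_square)
    also have "\<dots> = g \<bullet> (B *v ys)" unfolding ys_def by (rule inner_transpose_mult)
    also have "\<dots> \<le> norm g * norm ys"
      using norm_cauchy_schwarz[of g "B *v ys"] B[of ys] mult_left_mono[of _ _ "norm g"]
      by (meson norm_ge_zero order_trans)
    finally have ys_le: "norm ys \<le> norm g" by (cases "ys = 0") auto
    have "(ys, g - ys) \<in> rge (transpose B) (1 *\<^sub>R (mat 1 - transpose B))"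
      unfolding rge_def ys_def
      by (auto simp: matrix_vector_mult_diff_rdistrib simp del: transpose_matrix_vector)
    then have "(ys, g - ys) \<in> \<Union> (S_star (subdiff q) (d, ds))" using S by blast
    then have le: "\<bar>(g - ys) \<bullet> (d - xbar) - ys \<bullet> (ds + F xbar)\<bar> \<le> \<epsilon> / 3 * n * norm (g - ys, ys)"
      using \<delta>[OF gph] dist unfolding n_def dist_norm by blast
    have ys_inner: "ys \<bullet> v = g \<bullet> (B *v v)" for v unfolding ys_def by (rule inner_transpose_mult)
    have "norm g * norm g = g \<bullet> ((d - xbar) - B *v (d - xbar) - B *v (ds + F xbar))"
      unfolding g_def[symmetric] by (simp add: dot_square_norm power2_eq_square)
    also have "\<dots> = (g - ys) \<bullet> (d - xbar) - ys \<bullet> (ds + F xbar)"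
      unfolding inner_diff_left inner_diff_right[of g] ys_inner ..
    also have "\<dots> \<le> \<epsilon> / 3 * n * norm (g - ys, ys)" using le by linarith
    also have "\<dots> \<le> \<epsilon> / 3 * n * (3 * norm g)"
    proof (rule mult_left_mono)
      show "norm (g - ys, ys) \<le> 3 * norm g"
        using norm_Pair_le[of "g - ys" ys] norm_triangle_ineq4[of g ys] ys_le by linarith
      show "0 \<le> \<epsilon> / 3 * n" using \<open>\<epsilon> > 0\<close> by (simp add: n_def)
    qed
    also have "\<dots> = norm g * (\<epsilon> * n)" by simp
    finally have "norm g * norm g \<le> norm g * (\<epsilon> * n)" .
    then have "norm g \<le> \<epsilon> * n" using \<open>\<epsilon> > 0\<close> by (cases "g = 0") (auto simp: n_def)
    then show "norm ((d - xbar) - B *v (d - xbar) - B *v (ds + F xbar))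
        \<le> \<epsilon> * norm ((d, ds) - (xbar, - F xbar))"
      by (simp add: g_def n_def)
  qed
qed

section \<open>Local estimates for \<open>F\<close> and for the point of the graph computed from the
  iterate\<close>

lemma F_lipschitz_at:
  obtains K \<delta> where "K \<ge> 0" "\<delta> > 0" "\<And>x. norm (x - xbar) < \<delta> \<Longrightarrow> norm (F x - F xbar) \<le> K * norm (x - xbar)"
proof -
  let ?F' = "jacobian F (at xbar)"
  have F': "(F has_derivative (*v) ?F') (at xbar)" using F_diff jacobian_works by blast
  obtain \<delta> where \<delta>: "\<delta> > 0" "\<And>x. norm (x - xbar) < \<delta> \<Longrightarrow>
      norm (F x - F xbar - ?F' *v (x - xbar)) \<le> 1 * norm (x - xbar)"
    using F'[unfolded has_derivative_at_alt, THEN conjunct2, rule_format, OF zero_less_one] by blast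
  show ?thesis
  proof (rule that[of "1 + onorm ((*v) ?F')", OF _ \<delta>(1)])
    show "0 \<le> 1 + onorm ((*v) ?F')" using onorm_pos_le[of "(*v) ?F'"] by simp
    fix x assume x: "norm (x - xbar) < \<delta>"
    have "norm (F x - F xbar) \<le> norm (F x - F xbar - ?F' *v (x - xbar)) + norm (?F' *v (x - xbar))"
      using norm_triangle_sub[of "F x - F xbar" "?F' *v (x - xbar)"] by linarith
    also have "\<dots> \<le> 1 * norm (x - xbar) + onorm ((*v) ?F') * norm (x - xbar)"
      using \<delta>(2)[OF x] by (intro add_mono onorm) auto
    finally show "norm (F x - F xbar) \<le> (1 + onorm ((*v) ?F')) * norm (x - xbar)"
      by (simp add: distrib_right)
  qed
qed

text \<open>The derivative is taken at x rather than at \<open>xbar\<close>. Half of \<epsilon>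
  covers differentiability at \<open>xbar\<close>, half the variation of the Jacobian, whose
  continuity enters here.\<close>

lemma F_linearization:
  assumes "\<epsilon> > 0"
  obtains \<delta> where "\<delta> > 0"
    "\<And>x. norm (x - xbar) < \<delta> \<Longrightarrow>
      norm (jacobian F (at x) *v (x - xbar) - (F x - F xbar)) \<le> \<epsilon> * norm (x - xbar)"
proof -
  let ?F' = "\<lambda>x. jacobian F (at x)"
  obtain K where K: "K > 0" "\<And>(A::real^'n^'n) (w::real^'n). norm (A *v w) \<le> norm A * norm w * K"
    using bounded_bilinear.pos_bounded[OF bounded_bilinear_matrix_vector_mult] by metis
  have F': "(F has_derivative (*v) (?F' xbar)) (at xbar)" using F_diff jacobian_works by blast
  obtain \<delta>1 where \<delta>1: "\<delta>1 > 0" "\<And>x. norm (x - xbar) < \<delta>1 \<Longrightarrow>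
      norm (F x - F xbar - ?F' xbar *v (x - xbar)) \<le> \<epsilon> / 2 * norm (x - xbar)"
    using F'[unfolded has_derivative_at_alt, THEN conjunct2, rule_format, of "\<epsilon> / 2"] \<open>\<epsilon> > 0\<close>
    by auto
  have "\<epsilon> / (2 * K) > 0" using \<open>\<epsilon> > 0\<close> K by simp
  then obtain \<delta>2 where \<delta>2: "\<delta>2 > 0" "\<And>x. dist x xbar < \<delta>2 \<Longrightarrow> dist (?F' x) (?F' xbar) < \<epsilon> / (2 * K)"
    using F_C1 unfolding continuous_on_iff by (metis UNIV_I)
  show ?thesis
  proof (rule that[of "min \<delta>1 \<delta>2"])
    fix x assume x: "norm (x - xbar) < min \<delta>1 \<delta>2"
    have "norm ((?F' x - ?F' xbar) *v (x - xbar)) \<le> norm (?F' x - ?F' xbar) * norm (x - xbar) * K"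
      by (rule K)
    also have "\<dots> \<le> \<epsilon> / (2 * K) * norm (x - xbar) * K"
      using \<delta>2(2)[of x] x K(1) by (intro mult_right_mono) (auto simp: dist_norm)
    also have "\<dots> = \<epsilon> / 2 * norm (x - xbar)" using K(1) by simp
    finally have 1: "norm ((?F' x - ?F' xbar) *v (x - xbar)) \<le> \<epsilon> / 2 * norm (x - xbar)" .
    have "?F' x *v (x - xbar) - (F x - F xbar)
        = (?F' x - ?F' xbar) *v (x - xbar) - (F x - F xbar - ?F' xbar *v (x - xbar))"
      by (simp only: matrix_vector_mult_diff_rdistrib) simp
    then have "norm (?F' x *v (x - xbar) - (F x - F xbar))
        \<le> norm ((?F' x - ?F' xbar) *v (x - xbar)) + norm (F x - F xbar - ?F' xbar *v (x - xbar))"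
      by (simp only: norm_triangle_ineq4)
    also have "\<dots> \<le> \<epsilon> / 2 * norm (x - xbar) + \<epsilon> / 2 * norm (x - xbar)"
      using 1 \<delta>1(2)[of x] x by (intro add_mono) auto
    finally show "norm (?F' x *v (x - xbar) - (F x - F xbar)) \<le> \<epsilon> * norm (x - xbar)" by simp
  qed (use \<delta>1 \<delta>2 in auto)
qed

text \<open>For every \<gamma> the solution is the proximal point of xbar - F xbar / \<gamma>, so
  nonexpansiveness compares it with x + u. The constant is uniform in \<gamma>: the lower bound
  controls 1 / \<gamma> in the first component, the upper bound \<gamma> u in the second.\<close>

lemma approximate_point_estimate:
  assumes "0 < gl" "gl \<le> gu"
  obtains C \<delta> where "C > 0" "\<delta> > 0"
    "\<And>x \<gamma>. norm (x - xbar) < \<delta> \<Longrightarrow> \<gamma> \<in> {gl..gu} \<Longrightarrow>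
      norm ((x + prox_step \<gamma> F q x, - (\<gamma> *\<^sub>R prox_step \<gamma> F q x) - F x) - (xbar, - F xbar))
        \<le> C * norm (x - xbar)"
proof -
  obtain K \<delta> where K: "K \<ge> 0" "\<delta> > 0"
    "\<And>x. norm (x - xbar) < \<delta> \<Longrightarrow> norm (F x - F xbar) \<le> K * norm (x - xbar)"
    using F_lipschitz_at by metis
  \<comment> \<open>\<open>D\<close> bounds the first component, \<open>D + 1\<close> the step u =
    (x + u - xbar) - (x - xbar), and \<open>C\<close> adds the second component.\<close>
  define D where "D = 1 + K / gl"
  define C where "C = D + (gu * (D + 1) + K)"
  have "D > 0" using K(1) assms by (simp add: D_def add_pos_nonneg)
  have "C > 0" using K(1) assms \<open>D > 0\<close> by (simp add: C_def add_pos_nonneg)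
  show ?thesis
  proof (rule that[OF \<open>C > 0\<close> K(2)])
    fix x \<gamma> assume x: "norm (x - xbar) < \<delta>" and \<gamma>: "\<gamma> \<in> {gl..gu}"
    let ?u = "prox_step \<gamma> F q x" and ?e = "norm (x - xbar)"
    have "\<gamma> > 0" using \<gamma> assms by auto
    have d: "norm (x + ?u - xbar) \<le> D * ?e"
    proof -
      have "\<gamma> *\<^sub>R ((x - (1 / \<gamma>) *\<^sub>R F x) - (x + ?u)) \<in> subdiff q (x + ?u)"
        using prox_subdiff[OF q \<open>\<gamma> > 0\<close>, of "x - (1 / \<gamma>) *\<^sub>R F x"] by (simp add: prox_step_def)
      moreover have "\<gamma> *\<^sub>R ((xbar - (1 / \<gamma>) *\<^sub>R F xbar) - xbar) \<in> subdiff q xbar"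
        using sol \<open>\<gamma> > 0\<close> by (simp add: solves_iff)
      ultimately have "norm (x + ?u - xbar) \<le> norm ((x - (1 / \<gamma>) *\<^sub>R F x) - (xbar - (1 / \<gamma>) *\<^sub>R F xbar))"
        by (rule norm_diff_le_of_subdiff[OF q \<open>\<gamma> > 0\<close>])
      also have "\<dots> = norm ((x - xbar) - (1 / \<gamma>) *\<^sub>R (F x - F xbar))" by (simp add: algebra_simps)
      also have "\<dots> \<le> ?e + norm ((1 / \<gamma>) *\<^sub>R (F x - F xbar))" by (rule norm_triangle_ineq4)
      also have "norm ((1 / \<gamma>) *\<^sub>R (F x - F xbar)) \<le> (1 / gl) * (K * ?e)"
        unfolding norm_scaleR
        using \<gamma> assms K(1) K(3)[OF x] \<open>\<gamma> > 0\<close> by (intro mult_mono) (auto simp: frac_le)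
      finally show ?thesis by (simp add: D_def algebra_simps)
    qed
    have u: "norm ?u \<le> (D + 1) * ?e"
      using norm_triangle_ineq4[of "x + ?u - xbar" "x - xbar"] d by (simp add: algebra_simps)
    have "- (\<gamma> *\<^sub>R ?u) - F x - (- F xbar) = - (\<gamma> *\<^sub>R ?u) - (F x - F xbar)" by simp
    then have "norm (- (\<gamma> *\<^sub>R ?u) - F x - (- F xbar)) \<le> norm (- (\<gamma> *\<^sub>R ?u)) + norm (F x - F xbar)"
      by (simp only: norm_triangle_ineq4)
    also have "\<dots> \<le> gu * ((D + 1) * ?e) + K * ?e"
      using \<gamma> \<open>\<gamma> > 0\<close> u K(3)[OF x] by (intro add_mono) (auto intro: mult_mono)
    finally have ds: "norm (- (\<gamma> *\<^sub>R ?u) - F x - (- F xbar)) \<le> (gu * (D + 1) + K) * ?e"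
      by (simp add: algebra_simps)
    have "norm ((x + ?u, - (\<gamma> *\<^sub>R ?u) - F x) - (xbar, - F xbar))
        \<le> norm (x + ?u - xbar) + norm (- (\<gamma> *\<^sub>R ?u) - F x - (- F xbar))"
      unfolding diff_Pair by (rule norm_Pair_le)
    also have "\<dots> \<le> D * ?e + (gu * (D + 1) + K) * ?e" using d ds by (rule add_mono)
    also have "\<dots> = C * ?e" by (simp add: C_def distrib_right)
    finally show "norm ((x + ?u, - (\<gamma> *\<^sub>R ?u) - F x) - (xbar, - F xbar)) \<le> C * ?e" .
  qed
qed

text \<open>The second summand is the quantity controlled by \<open>semismooth_resolvent_estimate\<close> at the
  point of the graph computed from \<open>x\<close>.\<close>

lemma newton_error_identity:
  assumes "newton_matrix B x *v dx = (\<gamma> *\<^sub>R B + 1 *\<^sub>R (mat 1 - B)) *v u"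
  shows "newton_matrix B x *v (x + dx - xbar) =
    B *v (jacobian F (at x) *v (x - xbar) - (F x - F xbar))
    + ((x + u - xbar) - B *v (x + u - xbar) - B *v ((- (\<gamma> *\<^sub>R u) - F x) + F xbar))"
proof -
  have "x + dx - xbar = (x - xbar) + dx" by simp
  then have "newton_matrix B x *v (x + dx - xbar) = newton_matrix B x *v (x - xbar) + newton_matrix B x *v dx"
    by (simp only: matrix_vector_right_distrib)
  also have "\<dots> = B *v (jacobian F (at x) *v (x - xbar)) + ((x - xbar) - B *v (x - xbar))
      + (\<gamma> *\<^sub>R (B *v u) + (u - B *v u))"
  proof -
    have "newton_matrix B x *v dx = \<gamma> *\<^sub>R (B *v u) + (u - B *v u)"
      unfolding assms by (simp add: matrix_vector_mult_add_rdistrib matrix_vector_mult_diff_rdistrib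
        scaleR_matrix_vector_assoc[symmetric])
    then show ?thesis by (simp only: newton_matrix_mult)
  qed
  \<comment> \<open>B (F x - F xbar) is inserted and removed; together with \<gamma> B u it forms -
    B (ds + F xbar).\<close>
  finally show ?thesis
    by (simp add: matrix_vector_right_distrib matrix_vector_mult_diff_distrib
        matrix_vector_mult_minus_right matrix_vector_mult_scaleR)
qed

lemma algA_select_newton_matrix:
  assumes "0 < gl" "gl \<le> gu"
  obtains \<delta> c where "\<delta> > 0" "c > 0"
    "\<And>x \<gamma> X Y. norm (x - xbar) < \<delta> \<Longrightarrow> \<gamma> \<in> {gl..gu} \<Longrightarrow> algA_select F q \<gamma> x X Y \<Longrightarrow>
      \<exists>B. (\<forall>h. norm (B *v h) \<le> norm h) \<and>
        rge Y X = rge (transpose B) (1 *\<^sub>R (mat 1 - transpose B)) \<and>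
        (\<forall>w. c * norm w \<le> norm (newton_matrix B x *v w))"
proof -
  obtain r c where rc: "r > 0" "c > 0"
    "\<And>x z B w. norm (x - xbar) < r \<Longrightarrow> norm (z - (xbar - F xbar)) < r \<Longrightarrow>
      B \<in> bouligand_subdiff (prox 1 q) z \<Longrightarrow> c * norm w \<le> norm (newton_matrix B x *v w)"
    by (rule newton_matrix_bounded_below) blast
  obtain C \<delta> where C: "C > 0" "\<delta> > 0"
    "\<And>x \<gamma>. norm (x - xbar) < \<delta> \<Longrightarrow> \<gamma> \<in> {gl..gu} \<Longrightarrow>
      norm ((x + prox_step \<gamma> F q x, - (\<gamma> *\<^sub>R prox_step \<gamma> F q x) - F x) - (xbar, - F xbar))
        \<le> C * norm (x - xbar)"
    by (rule approximate_point_estimate[OF assms]) blast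
  show ?thesis
  proof (rule that[OF _ rc(2)])
    \<comment> \<open>The base point d + ds is within 2 C |x - xbar| of xbar - F xbar, and this must
      stay below \<open>r\<close>.\<close>
    show "min (min r \<delta>) (r / (2 * C)) > 0" using rc C by simp
  next
    fix x \<gamma> X Y
    assume x: "norm (x - xbar) < min (min r \<delta>) (r / (2 * C))" and \<gamma>: "\<gamma> \<in> {gl..gu}"
      and sel: "algA_select F q \<gamma> x X Y"
    let ?u = "prox_step \<gamma> F q x"
    let ?z = "x + ?u - (1 / 1) *\<^sub>R (\<gamma> *\<^sub>R ?u + F x)"
    obtain B where B: "B \<in> bouligand_subdiff (prox 1 q) ?z"
      "rge Y X = rge (transpose B) (1 *\<^sub>R (mat 1 - transpose B))"
      by (rule algA_select_bouligand[OF q zero_less_one sel])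
    let ?p = "(x + ?u, - (\<gamma> *\<^sub>R ?u) - F x) - (xbar, - F xbar)"
    have "?z - (xbar - F xbar) = fst ?p + snd ?p" by simp
    then have "norm (?z - (xbar - F xbar)) \<le> norm (fst ?p) + norm (snd ?p)"
      by (simp only: norm_triangle_ineq)
    also have "\<dots> \<le> norm ?p + norm ?p"
      using norm_fst_le[of "fst ?p" "snd ?p"] norm_snd_le[of "snd ?p" "fst ?p"]
      by (intro add_mono) (simp_all only: prod.collapse)
    also have "\<dots> \<le> 2 * C * norm (x - xbar)" using C(3)[OF _ \<gamma>, of x] x by simp
    also have "\<dots> < r" using x C(1) by (simp add: pos_less_divide_eq mult.commute)
    finally have "norm (?z - (xbar - F xbar)) < r" .
    then have "c * norm w \<le> norm (newton_matrix B x *v w)" for w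
      using rc(3)[OF _ _ B(1)] x by simp
    then show "\<exists>B. (\<forall>h. norm (B *v h) \<le> norm h) \<and>
        rge Y X = rge (transpose B) (1 *\<^sub>R (mat 1 - transpose B)) \<and>
        (\<forall>w. c * norm w \<le> norm (newton_matrix B x *v w))"
      using bouligand_subdiff_nonexpansive[OF nonexpansive B(1)] B(2) by blast
  qed
qed

text \<open>The SCD property makes \<open>S_star\<close> nonempty at the approximate point, and
  \<open>S_star_subset\<close> shows its elements to be ranges of matrix pairs, so a selection
  exists. Solvability is invertibility of the Newton matrix.\<close>

lemma newton_step_solvable:
  assumes "0 < gl" "gl \<le> gu"
  obtains \<delta> where "\<delta> > 0"
    "\<And>x \<gamma>. norm (x - xbar) < \<delta> \<Longrightarrow> \<gamma> \<in> {gl..gu} \<Longrightarrow> \<exists>X Y. algA_select F q \<gamma> x X Y"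
    "\<And>x \<gamma> X Y. norm (x - xbar) < \<delta> \<Longrightarrow> \<gamma> \<in> {gl..gu} \<Longrightarrow> algA_select F q \<gamma> x X Y \<Longrightarrow>
      \<exists>dx. algA_eq F q \<gamma> x X Y dx"
proof -
  obtain \<delta>1 c where 1: "\<delta>1 > 0" "c > 0"
    "\<And>x \<gamma> X Y. norm (x - xbar) < \<delta>1 \<Longrightarrow> \<gamma> \<in> {gl..gu} \<Longrightarrow> algA_select F q \<gamma> x X Y \<Longrightarrow>
      \<exists>B. (\<forall>h. norm (B *v h) \<le> norm h) \<and>
        rge Y X = rge (transpose B) (1 *\<^sub>R (mat 1 - transpose B)) \<and>
        (\<forall>w. c * norm w \<le> norm (newton_matrix B x *v w))"
    by (rule algA_select_newton_matrix[OF assms]) blast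
  obtain C \<delta>2 where C: "C > 0" "\<delta>2 > 0"
    "\<And>x \<gamma>. norm (x - xbar) < \<delta>2 \<Longrightarrow> \<gamma> \<in> {gl..gu} \<Longrightarrow>
      norm ((x + prox_step \<gamma> F q x, - (\<gamma> *\<^sub>R prox_step \<gamma> F q x) - F x) - (xbar, - F xbar))
        \<le> C * norm (x - xbar)"
    by (rule approximate_point_estimate[OF assms]) blast
  have "\<forall>\<^sub>F p in nhds (xbar, - F xbar). p \<in> gph (subdiff q) \<longrightarrow> S_star (subdiff q) p \<noteq> {}"
    using semismooth by (simp add: SCD_semismooth_at_def SCD_around_def)
  then obtain \<delta>3 where \<delta>3: "\<delta>3 > 0" "\<And>p. norm (p - (xbar, - F xbar)) < \<delta>3 \<Longrightarrow>
      p \<in> gph (subdiff q) \<Longrightarrow> S_star (subdiff q) p \<noteq> {}"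
    unfolding eventually_nhds_metric dist_norm by blast
  show ?thesis
  proof (rule that)
    show "min \<delta>1 (min \<delta>2 (\<delta>3 / C)) > 0" using 1 C \<delta>3 by simp
  next
    fix x \<gamma> assume x: "norm (x - xbar) < min \<delta>1 (min \<delta>2 (\<delta>3 / C))" and \<gamma>: "\<gamma> \<in> {gl..gu}"
    have "\<gamma> > 0" using \<gamma> assms by simp
    let ?p = "(x + prox_step \<gamma> F q x, - (\<gamma> *\<^sub>R prox_step \<gamma> F q x) - F x)"
    have "norm (?p - (xbar, - F xbar)) \<le> C * norm (x - xbar)" using C(3)[OF _ \<gamma>] x by simp
    also have "\<dots> < \<delta>3" using x C(1) by (simp add: pos_less_divide_eq mult.commute)
    finally have "S_star (subdiff q) ?p \<noteq> {}" using \<delta>3(2) prox_step_in_gph[OF q \<open>\<gamma> > 0\<close>] by blast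
    then obtain L where L: "L \<in> S_star (subdiff q) ?p" by blast
    then obtain B where "L = rge (transpose B) (1 *\<^sub>R (mat 1 - transpose B))"
      by (rule S_star_subset)
    then have "algA_select F q \<gamma> x (1 *\<^sub>R (mat 1 - transpose B)) (transpose B)"
      unfolding algA_select_def Let_def using L by simp
    then show "\<exists>X Y. algA_select F q \<gamma> x X Y" by blast
  next
    fix x \<gamma> X Y assume x: "norm (x - xbar) < min \<delta>1 (min \<delta>2 (\<delta>3 / C))" and \<gamma>: "\<gamma> \<in> {gl..gu}"
      and sel: "algA_select F q \<gamma> x X Y"
    obtain B where B: "rge Y X = rge (transpose B) (1 *\<^sub>R (mat 1 - transpose B))"
      "\<And>w. c * norm w \<le> norm (newton_matrix B x *v w)"
      using 1(3)[OF _ \<gamma> sel] x by auto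
    have lin: "linear ((*v) (newton_matrix B x))" by (rule matrix_vector_mul_linear)
    have "inj ((*v) (newton_matrix B x))"
      unfolding linear_injective_0[OF lin]
    proof (intro allI impI)
      fix w assume "newton_matrix B x *v w = 0"
      then have "c * norm w \<le> 0" using B(2)[of w] by (simp only: norm_zero)
      then show "w = 0" using 1(2) by (simp add: mult_le_0_iff)
    qed
    with lin have "surj ((*v) (newton_matrix B x))" by (rule linear_injective_imp_surjective) simp
    then obtain dx where "newton_matrix B x *v dx
        = (\<gamma> *\<^sub>R B + 1 *\<^sub>R (mat 1 - B)) *v prox_step \<gamma> F q x"
      by (metis surjD)
    then show "\<exists>dx. algA_eq F q \<gamma> x X Y dx"
      unfolding algA_eq_iff[OF zero_less_one B(1)] by blast
  qed
qed

lemma newton_step_estimate: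
  assumes "0 < gl" "gl \<le> gu" "\<epsilon> > 0"
  obtains \<delta> where "\<delta> > 0"
    "\<And>x \<gamma> X Y dx. norm (x - xbar) < \<delta> \<Longrightarrow> \<gamma> \<in> {gl..gu} \<Longrightarrow> algA_select F q \<gamma> x X Y \<Longrightarrow>
      algA_eq F q \<gamma> x X Y dx \<Longrightarrow> norm (x + dx - xbar) \<le> \<epsilon> * norm (x - xbar)"
proof -
  obtain \<delta>1 c where 1: "\<delta>1 > 0" "c > 0"
    "\<And>x \<gamma> X Y. norm (x - xbar) < \<delta>1 \<Longrightarrow> \<gamma> \<in> {gl..gu} \<Longrightarrow> algA_select F q \<gamma> x X Y \<Longrightarrow>
      \<exists>B. (\<forall>h. norm (B *v h) \<le> norm h) \<and>
        rge Y X = rge (transpose B) (1 *\<^sub>R (mat 1 - transpose B)) \<and>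
        (\<forall>w. c * norm w \<le> norm (newton_matrix B x *v w))"
    by (rule algA_select_newton_matrix[OF assms(1,2)]) blast
  obtain C \<delta>2 where C: "C > 0" "\<delta>2 > 0"
    "\<And>x \<gamma>. norm (x - xbar) < \<delta>2 \<Longrightarrow> \<gamma> \<in> {gl..gu} \<Longrightarrow>
      norm ((x + prox_step \<gamma> F q x, - (\<gamma> *\<^sub>R prox_step \<gamma> F q x) - F x) - (xbar, - F xbar))
        \<le> C * norm (x - xbar)"
    by (rule approximate_point_estimate[OF assms(1,2)]) blast
  \<comment> \<open>The two summands of \<open>newton_error_identity\<close> get c * \<epsilon> / 2
    each, to be divided by the lower bound c; for the second, the factor 1 / C offsets the distance
    of the approximate point.\<close>
  have "c * \<epsilon> / 2 > 0" using 1 assms by simp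
  then obtain \<delta>3 where \<delta>3: "\<delta>3 > 0" "\<And>x. norm (x - xbar) < \<delta>3 \<Longrightarrow>
      norm (jacobian F (at x) *v (x - xbar) - (F x - F xbar)) \<le> c * \<epsilon> / 2 * norm (x - xbar)"
    by (rule F_linearization) blast
  have "c * \<epsilon> / (2 * C) > 0" using 1 C assms by simp
  then obtain \<delta>4 where \<delta>4: "\<delta>4 > 0"
    "\<And>d ds B. (d, ds) \<in> gph (subdiff q) \<Longrightarrow> norm ((d, ds) - (xbar, - F xbar)) \<le> \<delta>4 \<Longrightarrow>
      rge (transpose B) (1 *\<^sub>R (mat 1 - transpose B)) \<in> S_star (subdiff q) (d, ds) \<Longrightarrow>
      (\<And>h. norm (B *v h) \<le> norm h) \<Longrightarrow>
      norm ((d - xbar) - B *v (d - xbar) - B *v (ds + F xbar))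
        \<le> c * \<epsilon> / (2 * C) * norm ((d, ds) - (xbar, - F xbar))"
    by (rule semismooth_resolvent_estimate) blast
  show ?thesis
  proof (rule that)
    show "min (min \<delta>1 \<delta>2) (min \<delta>3 (\<delta>4 / C)) > 0" using 1 C \<delta>3 \<delta>4 by simp
  next
    fix x \<gamma> X Y dx
    assume x: "norm (x - xbar) < min (min \<delta>1 \<delta>2) (min \<delta>3 (\<delta>4 / C))" and \<gamma>: "\<gamma> \<in> {gl..gu}"
      and sel: "algA_select F q \<gamma> x X Y" and eq: "algA_eq F q \<gamma> x X Y dx"
    have "\<gamma> > 0" using \<gamma> assms by simp
    let ?u = "prox_step \<gamma> F q x" and ?e = "norm (x - xbar)"
    let ?d = "x + ?u" and ?ds = "- (\<gamma> *\<^sub>R ?u) - F x"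
    let ?lin = "jacobian F (at x) *v (x - xbar) - (F x - F xbar)"
    obtain B where B: "\<And>h. norm (B *v h) \<le> norm h"
      "rge Y X = rge (transpose B) (1 *\<^sub>R (mat 1 - transpose B))"
      "\<And>w. c * norm w \<le> norm (newton_matrix B x *v w)"
      using 1(3)[OF _ \<gamma> sel] x by auto
    have p: "norm ((?d, ?ds) - (xbar, - F xbar)) \<le> C * ?e" using C(3)[OF _ \<gamma>] x by simp
    also have "\<dots> \<le> \<delta>4"
    proof -
      have "?e \<le> \<delta>4 / C" using x by simp
      then show ?thesis using C(1) by (simp add: pos_le_divide_eq mult.commute)
    qed
    finally have near: "norm ((?d, ?ds) - (xbar, - F xbar)) \<le> \<delta>4" .
    have S: "rge (transpose B) (1 *\<^sub>R (mat 1 - transpose B)) \<in> S_star (subdiff q) (?d, ?ds)"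
      using sel unfolding algA_select_def Let_def B(2) .
    have "norm ((?d - xbar) - B *v (?d - xbar) - B *v (?ds + F xbar))
        \<le> c * \<epsilon> / (2 * C) * norm ((?d, ?ds) - (xbar, - F xbar))"
      using \<delta>4(2)[OF prox_step_in_gph[OF q \<open>\<gamma> > 0\<close>] near S B(1)] .
    also have "\<dots> \<le> c * \<epsilon> / (2 * C) * (C * ?e)"
      using p \<open>c * \<epsilon> / (2 * C) > 0\<close> by (intro mult_left_mono) auto
    also have "\<dots> = c * \<epsilon> / 2 * ?e" using C(1) by simp
    finally have res: "norm ((?d - xbar) - B *v (?d - xbar) - B *v (?ds + F xbar)) \<le> c * \<epsilon> / 2 * ?e" .
    have lin: "norm (B *v ?lin) \<le> c * \<epsilon> / 2 * ?e"
      using B(1)[of ?lin] \<delta>3(2)[of x] x by auto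
    have "c * norm (x + dx - xbar) \<le> norm (newton_matrix B x *v (x + dx - xbar))" by (rule B(3))
    also have "\<dots> \<le> norm (B *v ?lin)
        + norm ((?d - xbar) - B *v (?d - xbar) - B *v (?ds + F xbar))"
      unfolding newton_error_identity[OF eq[unfolded algA_eq_iff[OF zero_less_one B(2)]]]
      by (rule norm_triangle_ineq)
    also have "\<dots> \<le> c * \<epsilon> / 2 * ?e + c * \<epsilon> / 2 * ?e" using lin res by (rule add_mono)
    also have "\<dots> = c * (\<epsilon> * ?e)" by simp
    finally show "norm (x + dx - xbar) \<le> \<epsilon> * ?e" using 1(2) by simp
  qed
qed

section \<open>Iterates started near the solution\<close>

lemma algA_iterates_contract:
  assumes step: "\<And>x \<gamma> X Y dx. norm (x - xbar) < \<delta> \<Longrightarrow> \<gamma> \<in> {gl..gu} \<Longrightarrow> algA_select F q \<gamma> x X Y \<Longrightarrow>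
      algA_eq F q \<gamma> x X Y dx \<Longrightarrow> norm (x + dx - xbar) \<le> 1 / 2 * norm (x - xbar)"
    and run: "algA F q \<gamma> X Y N x" and x0: "norm (x 0 - xbar) < \<delta>"
    and \<gamma>: "\<And>k. enat k < N \<Longrightarrow> \<gamma> k \<in> {gl..gu}"
  shows "enat k \<le> N \<Longrightarrow> norm (x k - xbar) \<le> (1 / 2) ^ k * norm (x 0 - xbar)"
proof (induction k)
  case (Suc k)
  \<comment> \<open>The bound \<open>enat k \<le> N\<close> admits the last iterate of a finite run,
    whose predecessor still satisfies the strict bound and so carries out an iteration.\<close>
  then have k: "enat k < N" by (simp add: Suc_ile_eq)
  then have IH: "norm (x k - xbar) \<le> (1 / 2) ^ k * norm (x 0 - xbar)" using Suc.IH by simp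
  also have "\<dots> \<le> 1 * norm (x 0 - xbar)" by (intro mult_right_mono power_le_one) auto
  finally have near: "norm (x k - xbar) < \<delta>" using x0 by simp
  obtain dx where "algA_eq F q (\<gamma> k) (x k) (X k) (Y k) dx" "x (Suc k) = x k + dx"
    "algA_select F q (\<gamma> k) (x k) (X k) (Y k)"
    using run k unfolding algA_def by blast
  then have "norm (x (Suc k) - xbar) \<le> 1 / 2 * norm (x k - xbar)"
    using step[OF near \<gamma>[OF k]] by simp
  then show ?case using IH by simp
qed simp

lemma algA_near_solution:
  assumes step: "\<And>x \<gamma> X Y dx. norm (x - xbar) < \<delta> \<Longrightarrow> \<gamma> \<in> {gl..gu} \<Longrightarrow> algA_select F q \<gamma> x X Y \<Longrightarrow>
      algA_eq F q \<gamma> x X Y dx \<Longrightarrow> norm (x + dx - xbar) \<le> 1 / 2 * norm (x - xbar)"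
    and run: "algA F q \<gamma> X Y N x" and x0: "norm (x 0 - xbar) < \<delta>"
    and \<gamma>: "\<And>k. enat k < N \<Longrightarrow> \<gamma> k \<in> {gl..gu}" and k: "enat k \<le> N"
  shows "norm (x k - xbar) < \<delta>"
proof -
  have "norm (x k - xbar) \<le> (1 / 2) ^ k * norm (x 0 - xbar)"
    using algA_iterates_contract[OF step run x0 \<gamma> k] .
  also have "\<dots> \<le> 1 * norm (x 0 - xbar)" by (intro mult_right_mono power_le_one) auto
  finally show ?thesis using x0 by simp
qed

text \<open>At a solution the zero step solves the Newton system, so the contraction estimate forces
  the solution to be \<open>xbar\<close>.\<close>

lemma locally_unique_solution:
  assumes step: "\<And>x \<gamma> X Y dx. norm (x - xbar) < \<delta> \<Longrightarrow> \<gamma> \<in> {gl..gu} \<Longrightarrow> algA_select F q \<gamma> x X Y \<Longrightarrow>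
      algA_eq F q \<gamma> x X Y dx \<Longrightarrow> norm (x + dx - xbar) \<le> 1 / 2 * norm (x - xbar)"
    and g: "0 < g" "g \<in> {gl..gu}"
    and sel: "\<exists>X Y. algA_select F q g x X Y" and "solves F q x" and x: "norm (x - xbar) < \<delta>"
  shows "x = xbar"
proof -
  obtain X Y where XY: "algA_select F q g x X Y" using sel by blast
  have "algA_eq F q g x X Y 0"
    unfolding algA_eq_def prox_step_eq_0[OF q g(1) \<open>solves F q x\<close>] by simp
  then have "norm (x + 0 - xbar) \<le> 1 / 2 * norm (x - xbar)"
    using step[OF x g(2) XY] by blast
  then show ?thesis by simp
qed

text \<open>The contraction by 1 / 2 gives convergence; once the limit is known, the step estimate
  applies with any \<epsilon> from some index on, which is the little-o.\<close>

lemma algA_superlinear: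
  assumes "0 < gl" "gl \<le> gu"
    and step: "\<And>x \<gamma> X Y dx. norm (x - xbar) < \<delta> \<Longrightarrow> \<gamma> \<in> {gl..gu} \<Longrightarrow> algA_select F q \<gamma> x X Y \<Longrightarrow>
      algA_eq F q \<gamma> x X Y dx \<Longrightarrow> norm (x + dx - xbar) \<le> 1 / 2 * norm (x - xbar)"
    and run: "algA F q \<gamma> X Y \<infinity> x" and x0: "norm (x 0 - xbar) < \<delta>"
    and \<gamma>: "\<And>k. \<gamma> k \<in> {gl..gu}"
  shows "superlinear \<infinity> x xbar"
proof -
  have "(\<lambda>k. x k - xbar) \<longlonglongrightarrow> 0"
  proof (rule Lim_null_comparison)
    show "\<forall>\<^sub>F k in sequentially. norm (x k - xbar) \<le> (1 / 2) ^ k * norm (x 0 - xbar)"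
      using algA_iterates_contract[OF step run x0 \<gamma>] by simp
    show "(\<lambda>k. (1 / 2) ^ k * norm (x 0 - xbar)) \<longlonglongrightarrow> 0"
      by (intro tendsto_mult_left_zero LIMSEQ_power_zero) simp
  qed
  then have lim: "x \<longlonglongrightarrow> xbar" by (rule LIM_zero_cancel)
  have "(\<lambda>k. norm (x (Suc k) - xbar)) \<in> o(\<lambda>k. norm (x k - xbar))"
  proof (rule landau_o.smallI)
    fix \<epsilon> :: real assume "\<epsilon> > 0"
    obtain d where d: "d > 0" "\<And>x \<gamma> X Y dx. norm (x - xbar) < d \<Longrightarrow> \<gamma> \<in> {gl..gu} \<Longrightarrow>
        algA_select F q \<gamma> x X Y \<Longrightarrow> algA_eq F q \<gamma> x X Y dx \<Longrightarrow>
        norm (x + dx - xbar) \<le> \<epsilon> * norm (x - xbar)"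
      by (rule newton_step_estimate[OF assms(1,2) \<open>\<epsilon> > 0\<close>]) blast
    have "\<forall>\<^sub>F k in sequentially. norm (x k - xbar) < d"
      using tendstoD[OF lim d(1)] by (simp add: dist_norm)
    then show "\<forall>\<^sub>F k in sequentially. norm (norm (x (Suc k) - xbar)) \<le> \<epsilon> * norm (norm (x k - xbar))"
    proof eventually_elim
      case (elim k)
      obtain dx where "algA_eq F q (\<gamma> k) (x k) (X k) (Y k) dx" "x (Suc k) = x k + dx"
        "algA_select F q (\<gamma> k) (x k) (X k) (Y k)"
        using run unfolding algA_def by (metis enat_ord_code(4))
      then show ?case using d(2)[OF elim \<gamma>] by simp
    qed
  qed
  with lim show ?thesis by (simp add: superlinear_def)
qed

end

theorem theorem5p1:
  fixes F :: "real^'n \<Rightarrow> real^'n" and q :: "real^'n \<Rightarrow> ereal" and xbar :: "real^'n"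
  assumes F_diff: "\<And>x. F differentiable at x"
    and F_C1: "continuous_on UNIV (\<lambda>x. jacobian F (at x))"
    and q: "closed_proper_convex q"
    and sol: "solves F q xbar"
    and semismooth: "SCD_semismooth_at (subdiff q) (xbar, - F xbar)"
    and regular: "SCD_regular_around (plus_map F (subdiff q)) (xbar, 0)"
  shows "(\<forall>\<gamma> X Y N x. algA F q \<gamma> X Y N x \<longrightarrow> (\<exists>V. algB F q \<gamma> V N x)) \<and>
    (\<forall>gl gu. 0 < gl \<and> gl \<le> gu \<longrightarrow>
      (\<exists>U. open U \<and> xbar \<in> U \<and> (\<forall>x0 \<in> U.
         \<comment> \<open>the method does not break down\<close>
         (\<forall>\<gamma> X Y m x. algA F q \<gamma> X Y (enat m) x \<and> x 0 = x0 \<and> (\<forall>k\<le>m. \<gamma> k \<in> {gl..gu}) \<and>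
             \<not> solves F q (x m) \<longrightarrow>
             (\<exists>Xm Ym. algA_select F q (\<gamma> m) (x m) Xm Ym) \<and>
             (\<forall>Xm Ym. algA_select F q (\<gamma> m) (x m) Xm Ym \<longrightarrow>
                (\<exists>dx. algA_eq F q (\<gamma> m) (x m) Xm Ym dx))) \<and>
         \<comment> \<open>every complete run converges superlinearly\<close>
         (\<forall>\<gamma> X Y N x. algA F q \<gamma> X Y N x \<and> complete_run F q N x \<and> x 0 = x0 \<and>
             (\<forall>k. enat k < N \<longrightarrow> \<gamma> k \<in> {gl..gu}) \<longrightarrow>
             superlinear N x xbar))))"
proof -
  interpret scd_newton F q xbar
    by (unfold_locales) (fact assms)+
  have instance_of_B: "\<exists>V. algB F q \<gamma> V N x" if run: "algA F q \<gamma> X Y N x" for \<gamma> X Y N x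
  proof -
    \<comment> \<open>The bound on k stays inside the existential so that one choice function serves
      all k.\<close>
    have "\<exists>V. enat k < N \<longrightarrow> V \<in> T_u (\<gamma> k) F q (x k) \<and>
        (\<exists>dx. V *v dx = - prox_step (\<gamma> k) F q (x k) \<and> x (Suc k) = x k + dx)" for k
    proof (cases "enat k < N")
      case True
      then obtain dx where "\<gamma> k > 0" "algA_select F q (\<gamma> k) (x k) (X k) (Y k)"
        "algA_eq F q (\<gamma> k) (x k) (X k) (Y k) dx" "x (Suc k) = x k + dx"
        using run unfolding algA_def by blast
      then show ?thesis using algA_step_is_algB_step[OF q] by blast
    qed simp
    then obtain V where "\<And>k. enat k < N \<longrightarrow> V k \<in> T_u (\<gamma> k) F q (x k) \<and>
        (\<exists>dx. V k *v dx = - prox_step (\<gamma> k) F q (x k) \<and> x (Suc k) = x k + dx)"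
      by metis
    then show ?thesis using run unfolding algA_def algB_def by blast
  qed
  have local_convergence: "\<exists>U. open U \<and> xbar \<in> U \<and> (\<forall>x0 \<in> U.
         (\<forall>\<gamma> X Y m x. algA F q \<gamma> X Y (enat m) x \<and> x 0 = x0 \<and> (\<forall>k\<le>m. \<gamma> k \<in> {gl..gu}) \<and>
             \<not> solves F q (x m) \<longrightarrow>
             (\<exists>Xm Ym. algA_select F q (\<gamma> m) (x m) Xm Ym) \<and>
             (\<forall>Xm Ym. algA_select F q (\<gamma> m) (x m) Xm Ym \<longrightarrow>
                (\<exists>dx. algA_eq F q (\<gamma> m) (x m) Xm Ym dx))) \<and>
         (\<forall>\<gamma> X Y N x. algA F q \<gamma> X Y N x \<and> complete_run F q N x \<and> x 0 = x0 \<and>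
             (\<forall>k. enat k < N \<longrightarrow> \<gamma> k \<in> {gl..gu}) \<longrightarrow>
             superlinear N x xbar))"
    if g: "0 < gl" "gl \<le> gu" for gl gu
  proof -
    obtain \<delta>1 where \<delta>1: "\<delta>1 > 0"
      "\<And>x \<gamma>. norm (x - xbar) < \<delta>1 \<Longrightarrow> \<gamma> \<in> {gl..gu} \<Longrightarrow> \<exists>X Y. algA_select F q \<gamma> x X Y"
      "\<And>x \<gamma> X Y. norm (x - xbar) < \<delta>1 \<Longrightarrow> \<gamma> \<in> {gl..gu} \<Longrightarrow> algA_select F q \<gamma> x X Y \<Longrightarrow>
        \<exists>dx. algA_eq F q \<gamma> x X Y dx"
      by (rule newton_step_solvable[OF g]) blast
    obtain \<delta>2 where \<delta>2: "\<delta>2 > 0" "\<And>x \<gamma> X Y dx. norm (x - xbar) < \<delta>2 \<Longrightarrow> \<gamma> \<in> {gl..gu} \<Longrightarrow>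
        algA_select F q \<gamma> x X Y \<Longrightarrow> algA_eq F q \<gamma> x X Y dx \<Longrightarrow>
        norm (x + dx - xbar) \<le> 1 / 2 * norm (x - xbar)"
      by (rule newton_step_estimate[OF g, of "1 / 2"]) (simp, blast)
    define \<delta> where "\<delta> = min \<delta>1 \<delta>2"
    have step: "norm (x + dx - xbar) \<le> 1 / 2 * norm (x - xbar)"
      if "norm (x - xbar) < \<delta>" "\<gamma> \<in> {gl..gu}" "algA_select F q \<gamma> x X Y" "algA_eq F q \<gamma> x X Y dx"
      for x \<gamma> X Y dx
      using \<delta>2(2) that by (simp add: \<delta>_def)
    have no_breakdown: "(\<exists>Xm Ym. algA_select F q (\<gamma> m) (x m) Xm Ym) \<and>
        (\<forall>Xm Ym. algA_select F q (\<gamma> m) (x m) Xm Ym \<longrightarrow> (\<exists>dx. algA_eq F q (\<gamma> m) (x m) Xm Ym dx))"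
      if run: "algA F q \<gamma> X Y (enat m) x" and x0: "norm (x 0 - xbar) < \<delta>"
        and \<gamma>: "\<forall>k\<le>m. \<gamma> k \<in> {gl..gu}" for \<gamma> X Y m x
    proof -
      have "norm (x m - xbar) < \<delta>"
        by (rule algA_near_solution[OF step run x0]) (use \<gamma> in auto)
      then have "norm (x m - xbar) < \<delta>1" by (simp add: \<delta>_def)
      moreover have "\<gamma> m \<in> {gl..gu}" using \<gamma> by blast
      ultimately show ?thesis using \<delta>1(2,3) by blast
    qed
    have convergence: "superlinear N x xbar"
      if run: "algA F q \<gamma> X Y N x" and complete: "complete_run F q N x" and x0: "norm (x 0 - xbar) < \<delta>"
        and \<gamma>: "\<forall>k. enat k < N \<longrightarrow> \<gamma> k \<in> {gl..gu}" for \<gamma> X Y N x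
    proof (cases N)
      case (enat m)
      have near: "norm (x m - xbar) < \<delta>"
        by (rule algA_near_solution[OF step run x0]) (use \<gamma> enat in auto)
      have "solves F q (x m)" using complete enat by (simp add: complete_run_def)
      \<comment> \<open>In a finite run the parameters are constrained only before index
        \<open>m\<close>, so \<open>gl\<close> stands in for the one at the last iterate;
        \<open>locally_unique_solution\<close> accepts any positive parameter in the
        interval.\<close>
      have gl: "gl \<in> {gl..gu}" using g by simp
      have "norm (x m - xbar) < \<delta>1" using near by (simp add: \<delta>_def)
      then have sel: "\<exists>X Y. algA_select F q gl (x m) X Y" using gl by (rule \<delta>1(2))
      have "x m = xbar"
        by (rule locally_unique_solution[OF _ g(1) gl sel \<open>solves F q (x m)\<close> near]) (rule step)
      then show ?thesis by (simp add: superlinear_def enat)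
    next
      case infinity
      have "algA F q \<gamma> X Y \<infinity> x" "\<gamma> k \<in> {gl..gu}" for k
        using run \<gamma> infinity by auto
      from algA_superlinear[OF g step this(1) x0 this(2)] have "superlinear \<infinity> x xbar" .
      then show ?thesis using infinity by simp
    qed
    have "open (ball xbar \<delta>)" "xbar \<in> ball xbar \<delta>"
      using \<delta>1(1) \<delta>2(1) by (simp_all add: \<delta>_def)
    moreover have "norm (x0 - xbar) < \<delta>" if "x0 \<in> ball xbar \<delta>" for x0
      using that by (simp add: dist_norm norm_minus_commute)
    ultimately show ?thesis
      using no_breakdown convergence by (intro exI[of _ "ball xbar \<delta>"] conjI ballI) blast+
  qed
  show ?thesis
    by (intro conjI allI impI; (erule conjE)?; (rule instance_of_B | rule local_convergence); assumption)
qed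

end
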